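(* A regular (unit speed) $C^2$ space curve is a slant helix if and only if it has a Frenet development $(\kappa_{SH},\tau_{SH})$ satisfying $$\kappa_{SH}=\frac1m\,\varphi'\cos\varphi,\qquad \tau_{SH}=\frac1m\,\varphi'\sin\varphi$$ with a differentiable function $\varphi(s)$ and $m=\cot\theta\neq0$ for some $\theta\in(0,\pi/2)$. Given such a Frenet development, let $n=\cos\theta$ (so that $n/m=\sin\theta$), $\Omega(s)=\varphi(s)/n$, $\lambda_1=1-n$, $\lambda_2=1+n$. Then the tangent vector of the slant helix thus characterized can be parametrized (up to a rotation of $\mathbb R^3$) as $$\mathbf T_{SH}(s)=\frac12\begin{pmatrix}\lambda_1\cos(\lambda_2\Omega(s))+\lambda_2\cos(\lambda_1\Omega(s))\\ \lambda_1\sin(\lambda_2\Omega(s))+\lambda_2\sin(\lambda_1\Omega(s))\\ 2\frac nm\sin(n\Omega(s))\end{pmatrix}.$$ Moreover, the slant helix is the successor curve of a helix with curvature $\kappa_H=\varphi'/m$ and torsion $\tau_H=\varphi'$; the regular arcs traced by $\mathbf T_{SH}$ are spherical helices; the slant helix has a Darboux vector with constant slope $\pi/2-\theta$ and speed of precession (signed Lancret curvature) $\omega=\kappa_H$; and slant helices are generic Frenet curves.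
   Context: All curves are unit speed (arc-length parametrized by $s$) $C^2$ curves $\mathbf x:I\to\mathbb R^3$, $I$ an interval, with unit tangent $\mathbf T=\mathbf x'$. A principal normal is a $C^1$ unit vector field $\mathbf N$ along the curve with $\mathbf N\perp\mathbf T$ and $\mathbf T'(s)$ a scalar multiple of $\mathbf N(s)$ for all $s$ (the scalar may be zero). A binormal is a $C^1$ unit vector field $\mathbf B$ with $\mathbf B\perp\mathbf T$, $\mathbf B'\perp\mathbf T$. A Frenet frame is a positively oriented orthonormal frame $(\mathbf T,\mathbf N,\mathbf B)$ of tangent, principal normal and binormal; a Frenet curve is a curve having one. The functions $\kappa=\langle\mathbf T',\mathbf N\rangle$ (signed curvature) and $\tau=\langle\mathbf N',\mathbf B\rangle$ (torsion) are continuous; $(\kappa,\tau)$ is called a Frenet development of the curve. A pair of continuous functions $(\kappa,\tau)$ determines a Frenet curve with this Frenet development uniquely up to rigid motion. The Darboux vector field is $\mathbf D_\omega=\tau\mathbf T+\kappa\mathbf B$; if $\mathbf D_\omega=\omega\mathbf D$ with $\mathbf D$ a continuous unit vector field (the unit Darboux vector), $\omega$ is called the signed Lancret curvature. A unit vector field has constant slope $\alpha$ if it makes the constant angle $\alpha$ with a fixed direction; a Darboux vector $\mathbf D_\omega=\omega\mathbf D$ has constant slope if its unit Darboux vector $\mathbf D$ has. A (general) helix is a curve whose unit tangent has constant slope $\theta\in(0,\pi/2)$; a spherical helix is a helix lying on a sphere; the regular arcs of $\mathbf T_{SH}$ are its arcs over parameter intervals where $\mathbf T_{SH}'\ne0$.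 A slant helix is a Frenet curve having a principal normal of constant slope $\theta\in(0,\pi/2)$. A curve $\mathbf x_1(s)$ is a successor curve of $\mathbf x(s)$ (same arc length parameter) if the tangent $\mathbf T$ of $\mathbf x$ is a principal normal of $\mathbf x_1$. A line segment of a curve is its restriction to a (nondegenerate) subinterval on which $\mathbf T'\equiv0$. A Frenet frame is generic if its curvature and torsion both vanish along every line segment (or there are no line segments); a Frenet curve is generic if it has a generic Frenet frame. *)

theory Defs
  imports "HOL-Analysis.Analysis"
begin

text \<open>
  Derivatives along a curve are taken \<open>within\<close> the parameter interval, so at an endpoint that
  belongs to the interval they are one-sided. All fields and functions are total on
  \<^typ>\<open>real\<close>, but only their values on the parameter interval matter.
\<close>

definition nondegenerate_interval :: "real set \<Rightarrow> bool" where
  "nondegenerate_interval I \<longleftrightarrow> is_interval I \<and> interior I \<noteq> {}"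

abbreviation derivative_on :: "real set \<Rightarrow> (real \<Rightarrow> real^3) \<Rightarrow> real \<Rightarrow> real^3" where
  "derivative_on I F s \<equiv> vector_derivative F (at s within I)"

definition C1_on :: "real set \<Rightarrow> (real \<Rightarrow> real^3) \<Rightarrow> bool" where
  "C1_on I F \<longleftrightarrow> F differentiable_on I \<and> continuous_on I (derivative_on I F)"

definition tangent :: "real set \<Rightarrow> (real \<Rightarrow> real^3) \<Rightarrow> real \<Rightarrow> real^3" where
  "tangent I x s = derivative_on I x s"

definition unit_speed_curve :: "real set \<Rightarrow> (real \<Rightarrow> real^3) \<Rightarrow> bool" where
  "unit_speed_curve I x \<longleftrightarrow> nondegenerate_interval I \<and>
     C1_on I x \<and> C1_on I (tangent I x) \<and> (\<forall>s\<in>I. norm (tangent I x s) = 1)"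

definition unit_field :: "real set \<Rightarrow> (real \<Rightarrow> real^3) \<Rightarrow> bool" where
  "unit_field I V \<longleftrightarrow> (\<forall>s\<in>I. norm (V s) = 1)"

definition principal_normal :: "real set \<Rightarrow> (real \<Rightarrow> real^3) \<Rightarrow> (real \<Rightarrow> real^3) \<Rightarrow> bool" where
  "principal_normal I x N \<longleftrightarrow> C1_on I N \<and> unit_field I N \<and>
     (\<forall>s\<in>I. N s \<bullet> tangent I x s = 0 \<and>
            (\<exists>c. derivative_on I (tangent I x) s = c *\<^sub>R N s))"

definition binormal :: "real set \<Rightarrow> (real \<Rightarrow> real^3) \<Rightarrow> (real \<Rightarrow> real^3) \<Rightarrow> bool" where
  "binormal I x B \<longleftrightarrow> C1_on I B \<and> unit_field I B \<and>
     (\<forall>s\<in>I. B s \<bullet> tangent I x s = 0 \<and> derivative_on I B s \<bullet> tangent I x s = 0)"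

text \<open>The tangent is determined by the curve, so a Frenet frame is given by \<open>N\<close> and \<open>B\<close>;
  \<open>T\<close>, \<open>N\<close>, \<open>B\<close> are unit and \<open>T\<close> is orthogonal to the other two by the first three conjuncts.\<close>

definition frenet_frame ::
  "real set \<Rightarrow> (real \<Rightarrow> real^3) \<Rightarrow> (real \<Rightarrow> real^3) \<Rightarrow> (real \<Rightarrow> real^3) \<Rightarrow> bool" where
  "frenet_frame I x N B \<longleftrightarrow> unit_speed_curve I x \<and> principal_normal I x N \<and> binormal I x B \<and>
     (\<forall>s\<in>I. N s \<bullet> B s = 0 \<and> det (vector [tangent I x s, N s, B s] :: real^3^3) > 0)"

definition frenet_curve :: "real set \<Rightarrow> (real \<Rightarrow> real^3) \<Rightarrow> bool" where
  "frenet_curve I x \<longleftrightarrow> (\<exists>N B. frenet_frame I x N B)"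

definition curvature :: "real set \<Rightarrow> (real \<Rightarrow> real^3) \<Rightarrow> (real \<Rightarrow> real^3) \<Rightarrow> real \<Rightarrow> real" where
  "curvature I x N s = derivative_on I (tangent I x) s \<bullet> N s"

definition torsion :: "real set \<Rightarrow> (real \<Rightarrow> real^3) \<Rightarrow> (real \<Rightarrow> real^3) \<Rightarrow> real \<Rightarrow> real" where
  "torsion I N B s = derivative_on I N s \<bullet> B s"

definition frame_development :: "real set \<Rightarrow> (real \<Rightarrow> real^3) \<Rightarrow>
    (real \<Rightarrow> real^3) \<Rightarrow> (real \<Rightarrow> real^3) \<Rightarrow> (real \<Rightarrow> real) \<Rightarrow> (real \<Rightarrow> real) \<Rightarrow> bool" where
  "frame_development I x N B \<kappa> \<tau> \<longleftrightarrow> frenet_frame I x N B \<and>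
     (\<forall>s\<in>I. \<kappa> s = curvature I x N s \<and> \<tau> s = torsion I N B s)"

definition frenet_development ::
  "real set \<Rightarrow> (real \<Rightarrow> real^3) \<Rightarrow> (real \<Rightarrow> real) \<Rightarrow> (real \<Rightarrow> real) \<Rightarrow> bool" where
  "frenet_development I x \<kappa> \<tau> \<longleftrightarrow> (\<exists>N B. frame_development I x N B \<kappa> \<tau>)"

definition darboux :: "real set \<Rightarrow> (real \<Rightarrow> real^3) \<Rightarrow>
    (real \<Rightarrow> real^3) \<Rightarrow> (real \<Rightarrow> real^3) \<Rightarrow> real \<Rightarrow> real^3" where
  "darboux I x N B s = torsion I N B s *\<^sub>R tangent I x s + curvature I x N s *\<^sub>R B s"

text \<open>\<open>D\<close> is a unit Darboux vector of the frame, with signed Lancret curvature \<open>\<omega>\<close>.\<close>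

definition unit_darboux :: "real set \<Rightarrow> (real \<Rightarrow> real^3) \<Rightarrow>
    (real \<Rightarrow> real^3) \<Rightarrow> (real \<Rightarrow> real^3) \<Rightarrow> (real \<Rightarrow> real) \<Rightarrow> (real \<Rightarrow> real^3) \<Rightarrow> bool" where
  "unit_darboux I x N B \<omega> D \<longleftrightarrow> continuous_on I D \<and> unit_field I D \<and>
     (\<forall>s\<in>I. darboux I x N B s = \<omega> s *\<^sub>R D s)"

text \<open>For unit vectors \<open>V s\<close> and \<open>u\<close>, the angle between them is \<open>arccos (V s \<bullet> u)\<close>.\<close>

definition constant_slope :: "real set \<Rightarrow> (real \<Rightarrow> real^3) \<Rightarrow> real \<Rightarrow> bool" where
  "constant_slope I V \<alpha> \<longleftrightarrow> unit_field I V \<and>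
     (\<exists>u. norm u = 1 \<and> (\<forall>s\<in>I. arccos (V s \<bullet> u) = \<alpha>))"

definition helix :: "real set \<Rightarrow> (real \<Rightarrow> real^3) \<Rightarrow> bool" where
  "helix I x \<longleftrightarrow> unit_speed_curve I x \<and>
     (\<exists>\<theta>. 0 < \<theta> \<and> \<theta> < pi / 2 \<and> constant_slope I (tangent I x) \<theta>)"

definition spherical_helix :: "real set \<Rightarrow> (real \<Rightarrow> real^3) \<Rightarrow> bool" where
  "spherical_helix I x \<longleftrightarrow> helix I x \<and> (\<exists>c r. r > 0 \<and> x ` I \<subseteq> sphere c r)"

definition slant_helix :: "real set \<Rightarrow> (real \<Rightarrow> real^3) \<Rightarrow> bool" where
  "slant_helix I x \<longleftrightarrow> frenet_curve I x \<and>
     (\<exists>N \<theta>. principal_normal I x N \<and> 0 < \<theta> \<and> \<theta> < pi / 2 \<and> constant_slope I N \<theta>)"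

text \<open>\<open>x1\<close> is a successor curve of \<open>x\<close>.\<close>

definition successor_curve :: "real set \<Rightarrow> (real \<Rightarrow> real^3) \<Rightarrow> (real \<Rightarrow> real^3) \<Rightarrow> bool" where
  "successor_curve I x x1 \<longleftrightarrow> unit_speed_curve I x \<and> unit_speed_curve I x1 \<and>
     principal_normal I x1 (tangent I x)"

text \<open>The arc of \<open>c\<close> over \<open>J\<close>, reparametrized by its arc length \<open>\<sigma>\<close>, is \<open>y\<close> on \<open>K\<close>. The starting
  value of the arc length parameter is arbitrary.\<close>

definition arc_length_reparametrization ::
  "real set \<Rightarrow> (real \<Rightarrow> real^3) \<Rightarrow> real set \<Rightarrow> (real \<Rightarrow> real^3) \<Rightarrow> bool" where
  "arc_length_reparametrization J c K y \<longleftrightarrow>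
     (\<exists>\<sigma>. (\<forall>s\<in>J. (\<sigma> has_real_derivative norm (derivative_on J c s)) (at s within J)) \<and>
          \<sigma> ` J = K \<and> (\<forall>s\<in>J. y (\<sigma> s) = c s))"

definition regular_arc :: "real set \<Rightarrow> (real \<Rightarrow> real^3) \<Rightarrow> real set \<Rightarrow> bool" where
  "regular_arc I c J \<longleftrightarrow> nondegenerate_interval J \<and> J \<subseteq> I \<and> (\<forall>s\<in>J. derivative_on I c s \<noteq> 0)"

definition line_segment :: "real set \<Rightarrow> (real \<Rightarrow> real^3) \<Rightarrow> real set \<Rightarrow> bool" where
  "line_segment I x J \<longleftrightarrow> nondegenerate_interval J \<and> J \<subseteq> I \<and>
     (\<forall>s\<in>J. derivative_on I (tangent I x) s = 0)"

definition generic_frame ::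
  "real set \<Rightarrow> (real \<Rightarrow> real^3) \<Rightarrow> (real \<Rightarrow> real^3) \<Rightarrow> (real \<Rightarrow> real^3) \<Rightarrow> bool" where
  "generic_frame I x N B \<longleftrightarrow> frenet_frame I x N B \<and>
     (\<forall>J. line_segment I x J \<longrightarrow> (\<forall>s\<in>J. curvature I x N s = 0 \<and> torsion I N B s = 0))"

definition generic_frenet_curve :: "real set \<Rightarrow> (real \<Rightarrow> real^3) \<Rightarrow> bool" where
  "generic_frenet_curve I x \<longleftrightarrow> (\<exists>N B. generic_frame I x N B)"

definition slant_form :: "real set \<Rightarrow> real \<Rightarrow> (real \<Rightarrow> real) \<Rightarrow> (real \<Rightarrow> real) \<Rightarrow>
    (real \<Rightarrow> real) \<Rightarrow> (real \<Rightarrow> real) \<Rightarrow> bool" where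
  "slant_form I \<theta> \<phi> \<phi>' \<kappa> \<tau> \<longleftrightarrow> 0 < \<theta> \<and> \<theta> < pi / 2 \<and>
     (\<forall>s\<in>I. (\<phi> has_real_derivative \<phi>' s) (at s within I)) \<and>
     (\<forall>s\<in>I. \<kappa> s = 1 / cot \<theta> * \<phi>' s * cos (\<phi> s) \<and> \<tau> s = 1 / cot \<theta> * \<phi>' s * sin (\<phi> s))"

definition slant_helix_tangent :: "real \<Rightarrow> (real \<Rightarrow> real) \<Rightarrow> real \<Rightarrow> real^3" where
  "slant_helix_tangent \<theta> \<phi> s =
    (let m = cot \<theta>; n = cos \<theta>; \<Omega> = \<phi> s / n; l1 = 1 - n; l2 = 1 + n
     in (1 / 2) *\<^sub>R vector [l1 * cos (l2 * \<Omega>) + l2 * cos (l1 * \<Omega>),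
                          l1 * sin (l2 * \<Omega>) + l2 * sin (l1 * \<Omega>),
                          2 * (n / m) * sin (n * \<Omega>)])"

end

theory Submission
  imports Defs
begin

text \<open>
  Everything is a sequence of rotations of one orthonormal frame. Let \<open>k = \<phi>' / cot \<theta>\<close>, so that
  \<open>\<kappa> = k cos \<phi>\<close> and \<open>\<tau> = k sin \<phi>\<close>. Turning the pair \<open>(B, T)\<close> of a Frenet frame by the angle \<open>\<phi>\<close>
  gives the unit Darboux vector \<open>D = cos \<phi> B + sin \<phi> T\<close> and \<open>M = - sin \<phi> B + cos \<phi> T\<close>. This angle
  makes \<open>D' = \<phi>' M\<close>, without a component along \<open>N\<close>, so \<open>(N, -M, D)\<close> satisfies the Frenet
  equations with curvature \<open>k\<close> and torsion \<open>\<phi>'\<close>: integrating \<open>N\<close> gives the helix of which the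
  slant helix is a successor (lemma \<open>predecessor_moving_frame\<close>). The curvature of this helix is
  \<open>tan \<theta>\<close> times its torsion. Therefore turning \<open>(N, D)\<close> by the constant angle
  \<open>\<theta>\<close> gives a fixed vector \<open>u = cos \<theta> N + sin \<theta> D\<close>, the common axis of \<open>N\<close> and \<open>D\<close>, and the
  remaining two vectors of the frame turn about \<open>u\<close> at the rate \<open>\<Omega>' = \<phi>' / cos \<theta>\<close>. A last rotation,
  by \<open>pi / 2 - \<Omega>\<close>, compensates this and leaves a fixed orthonormal basis; the coordinates of \<open>T\<close> in
  this basis are the claimed parametrization (lemma \<open>slant_axis_frame\<close>).

  Conversely, let a principal normal have constant slope \<open>\<theta>\<close> with respect to a unit vector \<open>u\<close>. Then
  \<open>(B \<bullet> u)\<^sup>2 + (T \<bullet> u)\<^sup>2 = (sin \<theta>)\<^sup>2\<close>, and \<open>\<phi>\<close> is the differentiable angle function of the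
  plane curve \<open>(B \<bullet> u, T \<bullet> u)\<close> (lemma \<open>slant_axis_development\<close>).

  Along a regular arc of the tangent indicatrix, the unit tangent of the indicatrix is \<open>N\<close> or \<open>-N\<close>
  throughout, hence of constant slope, and the indicatrix lies on the unit sphere (lemma
  \<open>tangent_indicatrix_arc\<close>). Along a line segment \<open>N' = \<tau> B\<close> and \<open>B' = - \<tau> N\<close>, while \<open>N \<bullet> u\<close> is a
  nonzero constant; this excludes torsion (lemma \<open>slant_torsion_vanishes_on_line_segment\<close>), so slant
  helices are generic.
\<close>

unbundle cross3_syntax

section \<open>Calculus on an interval\<close>

lemma nondegenerate_interval_iff:
  "nondegenerate_interval I \<longleftrightarrow> is_interval I \<and> (\<exists>a\<in>I. \<exists>b\<in>I. a < b)" for I :: "real set"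
proof -
  have "interior I \<noteq> {}" if "is_interval I" "a \<in> I" "b \<in> I" "a < b" for a b
  proof -
    have "{a<..<b} \<subseteq> I"
      using that mem_is_interval_1_I[of I a b] by auto
    then have "(a + b) / 2 \<in> interior I"
      using \<open>a < b\<close> by (intro interiorI[of "{a<..<b}"]) auto
    then show ?thesis by blast
  qed
  moreover have "\<exists>a\<in>I. \<exists>b\<in>I. a < b" if ne: "interior I \<noteq> {}"
  proof -
    obtain a e where e: "e > 0" "cball a e \<subseteq> I"
      using ne by (auto simp: mem_interior_cball)
    then have "a \<in> cball a e" "a + e \<in> cball a e"
      by (auto simp: dist_real_def)
    then show ?thesis
      using e by (intro bexI[of _ a] bexI[of _ "a + e"]) auto
  qed
  ultimately show ?thesis
    by (auto simp: nondegenerate_interval_def)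
qed

lemma nondegenerate_interval_convex: "nondegenerate_interval I \<Longrightarrow> convex I"
  by (simp add: nondegenerate_interval_def is_interval_convex)

lemma nondegenerate_interval_at_within:
  assumes "nondegenerate_interval I" "s \<in> I"
  shows "at s within I \<noteq> bot"
proof -
  have "connected I" "I \<noteq> {t}" for t
    using assms(1) by (auto simp: nondegenerate_interval_iff is_interval_connected_1)
  then have "s islimpt I"
    using assms(2) by (intro connected_imp_perfect)
  then show ?thesis
    by (simp add: trivial_limit_within)
qed

lemma derivative_on_eq:
  assumes "nondegenerate_interval I" "s \<in> I" "(F has_vector_derivative D) (at s within I)"
  shows "derivative_on I F s = D"
  using assms by (simp add: nondegenerate_interval_at_within vector_derivative_within)

lemma has_vector_derivative_derivative_on:
  assumes "F differentiable_on I" "s \<in> I"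
  shows "(F has_vector_derivative derivative_on I F s) (at s within I)"
  using assms by (simp add: differentiable_on_def vector_derivative_works[symmetric])

lemma has_vector_derivative_imp_continuous_on:
  assumes "\<And>s. s \<in> I \<Longrightarrow> (F has_vector_derivative F' s) (at s within I)"
  shows "continuous_on I F"
  using assms by (meson continuous_on_eq_continuous_within has_vector_derivative_continuous)

lemma C1_onI:
  assumes "nondegenerate_interval I"
    and "\<And>s. s \<in> I \<Longrightarrow> (F has_vector_derivative F' s) (at s within I)"
    and "continuous_on I F'"
  shows "C1_on I F"
  using assms derivative_on_eq[OF assms(1) _ assms(2)]
  by (auto simp: C1_on_def differentiable_on_def differentiable_def has_vector_derivative_def
      cong: continuous_on_cong)

lemma constant_on_interval:
  fixes F :: "real \<Rightarrow> 'a::real_normed_vector"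
  assumes "convex I" "\<And>s. s \<in> I \<Longrightarrow> (F has_vector_derivative 0) (at s within I)"
    and "s \<in> I" "t \<in> I"
  shows "F s = F t"
  using has_derivative_zero_constant[of I F] assms by (auto simp: has_vector_derivative_def)

text \<open>An integral from a base point \<open>s0\<close> works on every compact subinterval; a relative
  neighbourhood of a point of \<open>I\<close> is contained in such a subinterval, even at an endpoint of \<open>I\<close>.\<close>

lemma antiderivative_on_interval:
  fixes f :: "real \<Rightarrow> 'a::banach"
  assumes I: "is_interval I" and f: "continuous_on I f"
  obtains F where "\<And>s. s \<in> I \<Longrightarrow> (F has_vector_derivative f s) (at s within I)"
proof (cases "I = {}")
  case False
  then obtain s0 where s0: "s0 \<in> I" by blast
  define F where "F s = integral {s0..s} f - integral {s..s0} f" for s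
  have "(F has_vector_derivative f s) (at s within I)" if s: "s \<in> I" for s
  proof -
    obtain b where b: "b \<in> I" "s \<le> b" "s0 \<le> b" "s < b \<or> (\<forall>t\<in>I. t \<le> s)"
    proof (cases "\<exists>t\<in>I. s < t")
      case True
      then obtain t where t: "t \<in> I" "s < t" by blast
      then show ?thesis
        by (intro that[of "max t s0"]) (use s0 t in \<open>simp_all add: max_def\<close>)
    next
      case False
      then show ?thesis
        by (intro that[of s]) (use s s0 in \<open>simp_all add: not_less\<close>)
    qed
    obtain a where a: "a \<in> I" "a \<le> s" "a \<le> s0" "a < s \<or> (\<forall>t\<in>I. s \<le> t)"
    proof (cases "\<exists>t\<in>I. t < s")
      case True
      then obtain t where t: "t \<in> I" "t < s" by blast
      then show ?thesis
        by (intro that[of "min t s0"]) (use s0 t in \<open>simp_all add: min_def\<close>)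
    next
      case False
      then show ?thesis
        by (intro that[of s]) (use s s0 in \<open>simp_all add: not_less\<close>)
    qed
    have sub: "{a..b} \<subseteq> I"
      using mem_is_interval_1_I[OF I a(1) b(1)] by auto
    have cont: "continuous_on {a..b} f"
      using f sub continuous_on_subset by blast
    then have int: "f integrable_on {c..d}" if "a \<le> c" "d \<le> b" for c d
      using continuous_on_subset[OF cont, of "{c..d}"] that
      by (auto intro: integrable_continuous_real)
    have "((\<lambda>t. integral {a..t} f - integral {a..s0} f) has_vector_derivative f s)
        (at s within {a..b})"
      using integral_has_vector_derivative[OF cont, of s] a b
      by (auto intro!: derivative_eq_intros)
    moreover have "F t = integral {a..t} f - integral {a..s0} f" if t: "t \<in> {a..b}" for t
    proof (cases "s0 \<le> t")
      case True
      then have "integral {a..s0} f + integral {s0..t} f = integral {a..t} f"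
        using a t int by (intro Henstock_Kurzweil_Integration.integral_combine) auto
      then show ?thesis
        using True by (cases "t = s0") (auto simp: F_def algebra_simps)
    next
      case False
      then have "integral {a..t} f + integral {t..s0} f = integral {a..s0} f"
        using b t int by (intro Henstock_Kurzweil_Integration.integral_combine) auto
      then show ?thesis
        using False by (auto simp: F_def algebra_simps)
    qed
    ultimately have deriv: "(F has_vector_derivative f s) (at s within {a..b})"
      using a b by (intro has_vector_derivative_transform[where g = F]) auto
    \<comment> \<open>On a side where \<open>s\<close> is the endpoint of \<open>I\<close> there is no constraint; the value 1 stands for it.\<close>
    define e where "e = min (if a < s then s - a else 1) (if s < b then b - s else 1)"
    have "e > 0"
      by (auto simp: e_def)
    have "t \<in> {a..b}" if t: "t \<in> I" "dist t s < e" for t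
    proof -
      have "a \<le> t"
      proof (cases "a < s")
        case True
        then have "dist t s < s - a"
          using t by (simp add: e_def)
        then show ?thesis
          unfolding dist_real_def by linarith
      qed (use a t in auto)
      moreover have "t \<le> b"
      proof (cases "s < b")
        case True
        then have "dist t s < b - s"
          using t by (simp add: e_def)
        then show ?thesis
          unfolding dist_real_def by linarith
      qed (use b t in auto)
      ultimately show ?thesis by simp
    qed
    then have "I \<inter> ball s e - {s} = {a..b} \<inter> ball s e - {s}"
      using sub by (auto simp: dist_commute)
    then have "at s within I = at s within {a..b}"
      using \<open>e > 0\<close> by (intro at_within_nhd[where S = "ball s e"]) auto
    then show ?thesis
      using deriv by simp
  qed
  then show ?thesis by (rule that)
qed (use that[of "\<lambda>_. 0"] in simp)

text \<open>The angle function is the integral of \<open>X Y' - Y X'\<close>; with this choice the inner product of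
  \<open>(X, Y)\<close> and \<open>(cos \<phi>, sin \<phi>)\<close> has derivative zero, so it keeps its initial value 1.\<close>

lemma angle_function:
  fixes X Y X' Y' :: "real \<Rightarrow> real"
  assumes I: "is_interval I"
    and X: "\<And>s. s \<in> I \<Longrightarrow> (X has_real_derivative X' s) (at s within I)"
    and Y: "\<And>s. s \<in> I \<Longrightarrow> (Y has_real_derivative Y' s) (at s within I)"
    and cont: "continuous_on I X'" "continuous_on I Y'"
    and unit: "\<And>s. s \<in> I \<Longrightarrow> (X s)\<^sup>2 + (Y s)\<^sup>2 = 1"
    and tangential: "\<And>s. s \<in> I \<Longrightarrow> X s * X' s + Y s * Y' s = 0"
  obtains \<phi> where
    "\<And>s. s \<in> I \<Longrightarrow> (\<phi> has_real_derivative X s * Y' s - Y s * X' s) (at s within I)"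
    "\<And>s. s \<in> I \<Longrightarrow> X s = cos (\<phi> s) \<and> Y s = sin (\<phi> s)"
proof (cases "I = {}")
  case False
  then obtain s0 where s0: "s0 \<in> I" by blast
  define w where "w s = X s * Y' s - Y s * X' s" for s
  have "continuous_on I X" "continuous_on I Y"
    using X Y DERIV_continuous_on by blast+
  then have "continuous_on I w"
    unfolding w_def using cont by (intro continuous_intros)
  then obtain F where F: "\<And>s. s \<in> I \<Longrightarrow> (F has_vector_derivative w s) (at s within I)"
    using antiderivative_on_interval[OF I] by blast
  obtain t where t: "X s0 = cos t" "Y s0 = sin t"
    using sincos_total_2pi[OF unit[OF s0]] by blast
  define \<phi> where "\<phi> s = t - F s0 + F s" for s
  have \<phi>: "(\<phi> has_real_derivative w s) (at s within I)" if "s \<in> I" for s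
    using F[OF that] unfolding \<phi>_def has_real_derivative_iff_has_vector_derivative
    by (auto intro!: derivative_eq_intros)
  have rotating: "X' s = - w s * Y s \<and> Y' s = w s * X s" if "s \<in> I" for s
    using unit[OF that] tangential[OF that] unfolding w_def by algebra
  define h where "h s = X s * cos (\<phi> s) + Y s * sin (\<phi> s)" for s
  have "(h has_vector_derivative 0) (at s within I)" if "s \<in> I" for s
    unfolding h_def has_real_derivative_iff_has_vector_derivative[symmetric]
    using rotating[OF that]
    by (auto intro!: derivative_eq_intros X Y \<phi> that simp: algebra_simps)
  then have h: "h s = h s0" if "s \<in> I" for s
    using constant_on_interval[of I h s s0] I s0 that by (simp add: is_interval_convex)
  have h1: "h s = 1" if "s \<in> I" for s
    using h[OF that] t by (simp add: h_def \<phi>_def power2_eq_square[symmetric])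
  have "X s = cos (\<phi> s) \<and> Y s = sin (\<phi> s)" if "s \<in> I" for s
  proof -
    have "(X s - cos (\<phi> s))\<^sup>2 + (Y s - sin (\<phi> s))\<^sup>2 = 0"
      using unit[OF that] h1[OF that] sin_cos_squared_add[of "\<phi> s"] unfolding h_def by algebra
    then show ?thesis
      by (simp add: sum_power2_eq_zero_iff)
  qed
  then show ?thesis
    using that[of \<phi>] \<phi> by (auto simp: w_def)
qed (use that[of "\<lambda>_. 0"] in simp)

text \<open>With a positive derivative, \<open>\<sigma>\<close> is a homeomorphism onto its image, and the inverse function
  rule applies relative to the interval and its image, endpoints included.\<close>

lemma increasing_reparametrization:
  fixes \<sigma> v :: "real \<Rightarrow> real"
  assumes J: "nondegenerate_interval J"
    and \<sigma>: "\<And>s. s \<in> J \<Longrightarrow> (\<sigma> has_real_derivative v s) (at s within J)"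
    and v: "\<And>s. s \<in> J \<Longrightarrow> v s > 0"
  obtains g where "nondegenerate_interval (\<sigma> ` J)" "continuous_on (\<sigma> ` J) g"
    "\<And>s. s \<in> J \<Longrightarrow> g (\<sigma> s) = s"
    "\<And>s. s \<in> J \<Longrightarrow> (g has_real_derivative 1 / v s) (at (\<sigma> s) within \<sigma> ` J)"
proof -
  have cont: "continuous_on J \<sigma>"
    using \<sigma> DERIV_continuous_on by blast
  have int: "is_interval J"
    using J by (simp add: nondegenerate_interval_iff)
  have mono: "\<sigma> a < \<sigma> b" if ab: "a \<in> J" "b \<in> J" "a < b" for a b
  proof -
    have sub: "{a..b} \<subseteq> J"
      using mem_is_interval_1_I[OF int ab(1,2)] by auto
    have "(\<sigma> has_derivative (\<lambda>h. v s * h)) (at s within {a..b})" if "a \<le> s" "s \<le> b" for s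
      using has_derivative_subset[OF \<sigma>[unfolded has_field_derivative_def, of s] sub] sub that
      by auto
    then obtain s where s: "s \<in> {a..b}" "\<sigma> b - \<sigma> a = v s * (b - a)"
      using mvt_very_simple[OF less_imp_le[OF ab(3)], of \<sigma> "\<lambda>s h. v s * h"] by auto
    then have "v s * (b - a) > 0"
      using v[of s] sub \<open>a < b\<close> by auto
    then show ?thesis using s by simp
  qed
  then have inj: "inj_on \<sigma> J"
    by (intro linorder_inj_onI') (simp add: less_imp_neq)
  obtain g where g: "homeomorphism J (\<sigma> ` J) \<sigma> g"
    using homeomorphism_into_1d[of J \<sigma> "\<sigma> ` J"] int cont inj
    by (auto simp: is_interval_path_connected_1)
  then have g_cont: "continuous_on (\<sigma> ` J) g" and g_inv: "\<And>s. s \<in> J \<Longrightarrow> g (\<sigma> s) = s"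
    by (auto simp: homeomorphism_def)
  obtain a b where "a \<in> J" "b \<in> J" "a < b"
    using J by (auto simp: nondegenerate_interval_iff)
  then have "nondegenerate_interval (\<sigma> ` J)"
    using mono[of a b] connected_continuous_image[OF cont] int
    by (auto simp: nondegenerate_interval_iff is_interval_connected_1)
  moreover have "(g has_real_derivative 1 / v s) (at (\<sigma> s) within \<sigma> ` J)" if s: "s \<in> J" for s
    unfolding has_field_derivative_def
  proof (rule has_derivative_inverse_within)
    show "(\<sigma> has_derivative (*) (v s)) (at s within J)"
      using \<sigma>[OF s] by (simp add: has_field_derivative_def)
    show "continuous (at (\<sigma> s) within \<sigma> ` J) g"
      using g_cont s by (auto simp: continuous_on_eq_continuous_within)
    show "linear ((*) (1 / v s))"
      by (simp add: linear_times)
    show "(*) (1 / v s) \<circ> (*) (v s) = id"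
      using v[OF s] by auto
  qed (use s g_inv in auto)
  ultimately show ?thesis
    using that[of g] g_cont g_inv by blast
qed

section \<open>Moving orthonormal frames\<close>

definition oriented_orthonormal :: "real^3 \<Rightarrow> real^3 \<Rightarrow> real^3 \<Rightarrow> bool" where
  "oriented_orthonormal p q r \<longleftrightarrow> norm p = 1 \<and> norm q = 1 \<and> p \<bullet> q = 0 \<and> r = p \<times> q"

lemma oriented_orthonormal_inner:
  assumes "oriented_orthonormal p q r"
  shows "p \<bullet> p = 1" "q \<bullet> q = 1" "r \<bullet> r = 1" "p \<bullet> q = 0" "q \<bullet> p = 0" "p \<bullet> r = 0" "r \<bullet> p = 0"
    "q \<bullet> r = 0" "r \<bullet> q = 0"
proof -
  have "(norm r)\<^sup>2 = 1"
    using assms norm_cross_dot[of p q] by (simp add: oriented_orthonormal_def)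
  then show "r \<bullet> r = 1"
    by (simp add: power2_norm_eq_inner)
qed (use assms in \<open>auto simp: oriented_orthonormal_def dot_cross_self inner_commute norm_eq_1\<close>)

lemma oriented_orthonormal_expand:
  assumes "oriented_orthonormal p q r"
  shows "v = (v \<bullet> p) *\<^sub>R p + (v \<bullet> q) *\<^sub>R q + (v \<bullet> r) *\<^sub>R r"
proof -
  note i = oriented_orthonormal_inner[OF assms]
  define d where "d = v - ((v \<bullet> p) *\<^sub>R p + (v \<bullet> q) *\<^sub>R q + (v \<bullet> r) *\<^sub>R r)"
  have d: "d \<bullet> p = 0" "d \<bullet> q = 0" "d \<bullet> r = 0"
    by (simp_all add: d_def inner_simps i)
  have "d \<times> (p \<times> q) = (d \<bullet> q) *\<^sub>R p - (d \<bullet> p) *\<^sub>R q"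
    by (simp add: Lagrange)
  then have "d \<times> r = 0"
    using assms d by (simp add: oriented_orthonormal_def)
  moreover have "r \<noteq> 0"
    using i by auto
  ultimately have "d = 0"
    using d(3) norm_and_cross_eq_0 by blast
  then show ?thesis
    by (simp add: d_def)
qed

lemma oriented_orthonormal_cycle:
  assumes "oriented_orthonormal p q r"
  shows "oriented_orthonormal q r p"
proof -
  have "q \<times> (p \<times> q) = (q \<bullet> q) *\<^sub>R p - (q \<bullet> p) *\<^sub>R q"
    by (simp add: Lagrange)
  then show ?thesis
    using assms oriented_orthonormal_inner[OF assms]
    by (auto simp: oriented_orthonormal_def norm_eq_1)
qed

lemma oriented_orthonormal_rotate:
  assumes "oriented_orthonormal p q r"
  shows "oriented_orthonormal (cos t *\<^sub>R p + sin t *\<^sub>R q) (- sin t *\<^sub>R p + cos t *\<^sub>R q) r"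
proof -
  note i = oriented_orthonormal_inner[OF assms]
  have "r = p \<times> q"
    using assms by (simp add: oriented_orthonormal_def)
  moreover have "(a *\<^sub>R p + b *\<^sub>R q) \<times> (- b *\<^sub>R p + a *\<^sub>R q) = (a\<^sup>2 + b\<^sup>2) *\<^sub>R (p \<times> q)"
    for a b :: real
    by (simp add: cross3_simps power2_eq_square)
  ultimately show ?thesis
    by (simp add: oriented_orthonormal_def norm_eq_1 inner_simps i power2_eq_square[symmetric])
qed

text \<open>The rates are named by position: \<open>a\<close> between the first two vectors, \<open>b\<close> between the first and
  the third, \<open>c\<close> between the last two. The Frenet equations are the case
  \<open>(a, b, c) = (\<kappa>, 0, \<tau>)\<close>.\<close>

definition moving_frame :: "real set \<Rightarrow> (real \<Rightarrow> real^3) \<Rightarrow> (real \<Rightarrow> real^3) \<Rightarrow> (real \<Rightarrow> real^3) \<Rightarrow>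
    (real \<Rightarrow> real) \<Rightarrow> (real \<Rightarrow> real) \<Rightarrow> (real \<Rightarrow> real) \<Rightarrow> bool" where
  "moving_frame I P Q R a b c \<longleftrightarrow> (\<forall>s\<in>I. oriented_orthonormal (P s) (Q s) (R s) \<and>
     (P has_vector_derivative a s *\<^sub>R Q s + b s *\<^sub>R R s) (at s within I) \<and>
     (Q has_vector_derivative - a s *\<^sub>R P s + c s *\<^sub>R R s) (at s within I) \<and>
     (R has_vector_derivative - b s *\<^sub>R P s - c s *\<^sub>R Q s) (at s within I))"

lemma moving_frame_cong:
  assumes "moving_frame I P Q R a b c"
    and "\<And>s. s \<in> I \<Longrightarrow> P' s = P s" "\<And>s. s \<in> I \<Longrightarrow> Q' s = Q s" "\<And>s. s \<in> I \<Longrightarrow> R' s = R s"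
    and "\<And>s. s \<in> I \<Longrightarrow> a' s = a s" "\<And>s. s \<in> I \<Longrightarrow> b' s = b s" "\<And>s. s \<in> I \<Longrightarrow> c' s = c s"
  shows "moving_frame I P' Q' R' a' b' c'"
  using assms unfolding moving_frame_def
  by (auto intro!: has_vector_derivative_transform[where g = P' and f = P]
      has_vector_derivative_transform[where g = Q' and f = Q]
      has_vector_derivative_transform[where g = R' and f = R])

lemma moving_frame_cycle:
  assumes "moving_frame I P Q R a b c"
  shows "moving_frame I Q R P c (\<lambda>s. - a s) (\<lambda>s. - b s)"
  using assms unfolding moving_frame_def
  by (auto simp: oriented_orthonormal_cycle algebra_simps)

text \<open>Turning the first two vectors by an angle \<open>\<psi>\<close> in their plane adds \<open>\<psi>'\<close> to the rate \<open>a\<close> at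
  which they turn into each other and turns the pair \<open>(b, c)\<close> by the same angle.\<close>

lemma moving_frame_rotate:
  assumes "moving_frame I P Q R a b c"
    and "\<And>s. s \<in> I \<Longrightarrow> (\<psi> has_real_derivative \<psi>' s) (at s within I)"
  shows "moving_frame I (\<lambda>s. cos (\<psi> s) *\<^sub>R P s + sin (\<psi> s) *\<^sub>R Q s)
    (\<lambda>s. - sin (\<psi> s) *\<^sub>R P s + cos (\<psi> s) *\<^sub>R Q s) R
    (\<lambda>s. a s + \<psi>' s) (\<lambda>s. b s * cos (\<psi> s) + c s * sin (\<psi> s))
    (\<lambda>s. - b s * sin (\<psi> s) + c s * cos (\<psi> s))"
  unfolding moving_frame_def
proof (intro ballI conjI)
  fix s assume s: "s \<in> I"
  let ?C = "cos (\<psi> s)" and ?S = "sin (\<psi> s)"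
  let ?P = "?C *\<^sub>R P s + ?S *\<^sub>R Q s" and ?Q = "- ?S *\<^sub>R P s + ?C *\<^sub>R Q s"
  let ?b = "b s * ?C + c s * ?S" and ?c = "- b s * ?S + c s * ?C"
  have P: "(P has_vector_derivative a s *\<^sub>R Q s + b s *\<^sub>R R s) (at s within I)"
    and Q: "(Q has_vector_derivative - a s *\<^sub>R P s + c s *\<^sub>R R s) (at s within I)"
    and R: "(R has_vector_derivative - b s *\<^sub>R P s - c s *\<^sub>R Q s) (at s within I)"
    and o: "oriented_orthonormal (P s) (Q s) (R s)"
    using assms(1) s by (auto simp: moving_frame_def)
  show "oriented_orthonormal ?P ?Q (R s)"
    using o by (rule oriented_orthonormal_rotate)
  show "((\<lambda>s. cos (\<psi> s) *\<^sub>R P s + sin (\<psi> s) *\<^sub>R Q s) has_vector_derivative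
      (a s + \<psi>' s) *\<^sub>R ?Q + ?b *\<^sub>R R s) (at s within I)"
    by (rule derivative_eq_intros P Q assms(2) s refl)+ (simp add: algebra_simps)
  show "((\<lambda>s. - sin (\<psi> s) *\<^sub>R P s + cos (\<psi> s) *\<^sub>R Q s) has_vector_derivative
      - (a s + \<psi>' s) *\<^sub>R ?P + ?c *\<^sub>R R s) (at s within I)"
    by (rule derivative_eq_intros P Q assms(2) s refl)+ (simp add: algebra_simps)
  have cs: "?C * ?C + ?S * ?S = 1"
    by (simp add: power2_eq_square[symmetric])
  have bc: "?b * ?C - ?c * ?S = b s" "?b * ?S + ?c * ?C = c s"
    using cs by algebra+
  have "- ?b *\<^sub>R ?P - ?c *\<^sub>R ?Q = - (?b * ?C - ?c * ?S) *\<^sub>R P s - (?b * ?S + ?c * ?C) *\<^sub>R Q s"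
    by (simp only: scaleR_add_right scaleR_scaleR scaleR_diff_left scaleR_add_left) 
       (simp add: algebra_simps)
  then have "- ?b *\<^sub>R ?P - ?c *\<^sub>R ?Q = - b s *\<^sub>R P s - c s *\<^sub>R Q s"
    unfolding bc .
  then show "(R has_vector_derivative - ?b *\<^sub>R ?P - ?c *\<^sub>R ?Q) (at s within I)"
    using R by simp
qed

lemma moving_frame_constant:
  assumes "moving_frame I P Q R (\<lambda>_. 0) (\<lambda>_. 0) (\<lambda>_. 0)" "convex I" "s \<in> I" "t \<in> I"
  shows "P s = P t" "Q s = Q t" "R s = R t"
  using assms constant_on_interval[of I P s t] constant_on_interval[of I Q s t]
    constant_on_interval[of I R s t] by (simp_all add: moving_frame_def)

section \<open>Frenet frames as moving frames\<close>

lemma has_vector_derivative_inner: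
  assumes "(f has_vector_derivative f') (at s within I)" "(g has_vector_derivative g') (at s within I)"
  shows "((\<lambda>t. f t \<bullet> g t) has_real_derivative f s \<bullet> g' + f' \<bullet> g s) (at s within I)"
  using bounded_bilinear.has_vector_derivative[OF bounded_bilinear_inner assms]
  by (simp add: has_real_derivative_iff_has_vector_derivative)

lemma has_vector_derivative_cross:
  assumes "(f has_vector_derivative f') (at s within I)" "(g has_vector_derivative g') (at s within I)"
  shows "((\<lambda>t. f t \<times> g t) has_vector_derivative f s \<times> g' + f' \<times> g s) (at s within I)"
proof -
  have "bounded_bilinear (\<times>)"
    using bilinear_cross by (simp add: bilinear_conv_bounded_bilinear)
  from bounded_bilinear.has_vector_derivative[OF this assms] show ?thesis .
qed

lemma real_derivative_unique_on:
  fixes f :: "real \<Rightarrow> real"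
  assumes "nondegenerate_interval I" "s \<in> I"
    and "(f has_real_derivative a) (at s within I)" "(f has_real_derivative b) (at s within I)"
  shows "a = b"
  using assms nondegenerate_interval_at_within vector_derivative_unique_within
  by (metis has_real_derivative_iff_has_vector_derivative)

lemma inner_derivative_of_constant:
  assumes "nondegenerate_interval I" "s \<in> I"
    and "(f has_vector_derivative f') (at s within I)" "(g has_vector_derivative g') (at s within I)"
    and "\<And>t. t \<in> I \<Longrightarrow> f t \<bullet> g t = c"
  shows "f s \<bullet> g' + f' \<bullet> g s = 0"
proof (rule real_derivative_unique_on[OF assms(1,2)])
  show "((\<lambda>t. f t \<bullet> g t) has_real_derivative f s \<bullet> g' + f' \<bullet> g s) (at s within I)"
    using assms(3,4) by (rule has_vector_derivative_inner)
  have "((\<lambda>t. f t \<bullet> g t) has_vector_derivative 0) (at s within I)"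
    by (rule has_vector_derivative_transform[where f = "\<lambda>_. c"]) (use assms(2,5) in simp_all)
  then show "((\<lambda>t. f t \<bullet> g t) has_real_derivative 0) (at s within I)"
    by (simp add: has_real_derivative_iff_has_vector_derivative)
qed

text \<open>A principal normal determines the rest of a Frenet frame: \<open>T' \<times> N\<close> vanishes, so the derivative
  of \<open>T \<times> N\<close> is \<open>T \<times> N'\<close>, which is orthogonal to \<open>T\<close>.\<close>

lemma principal_normal_moving_frame:
  assumes curve: "unit_speed_curve I x" and normal: "principal_normal I x N"
  defines "B \<equiv> \<lambda>s. tangent I x s \<times> N s"
  shows "moving_frame I (tangent I x) N B (curvature I x N) (\<lambda>_. 0) (torsion I N B)"
    and "continuous_on I (curvature I x N)" "continuous_on I (torsion I N B)"
proof -
  let ?T = "tangent I x"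
  let ?T' = "derivative_on I ?T" and ?N' = "derivative_on I N"
  have I: "nondegenerate_interval I"
    using curve by (simp add: unit_speed_curve_def)
  have T: "(?T has_vector_derivative ?T' s) (at s within I)" if "s \<in> I" for s
    using curve that by (auto simp: unit_speed_curve_def C1_on_def
        intro: has_vector_derivative_derivative_on)
  have N: "(N has_vector_derivative ?N' s) (at s within I)" if "s \<in> I" for s
    using normal that by (auto simp: principal_normal_def C1_on_def
        intro: has_vector_derivative_derivative_on)
  have unit: "?T s \<bullet> ?T s = 1" "N s \<bullet> N s = 1" "N s \<bullet> ?T s = 0" if "s \<in> I" for s
    using curve normal that
    by (auto simp: unit_speed_curve_def principal_normal_def unit_field_def norm_eq_1)
  have o: "oriented_orthonormal (?T s) (N s) (B s)" if "s \<in> I" for s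
    using unit[OF that] by (simp add: oriented_orthonormal_def B_def norm_eq_1 inner_commute)
  have cont_T': "continuous_on I ?T'" and cont_N': "continuous_on I ?N'"
    using curve normal by (auto simp: unit_speed_curve_def principal_normal_def C1_on_def)
  have cont_T: "continuous_on I ?T" and cont_N: "continuous_on I N"
    using has_vector_derivative_imp_continuous_on[OF T] has_vector_derivative_imp_continuous_on[OF N]
    by simp_all
  show "continuous_on I (curvature I x N)" "continuous_on I (torsion I N B)"
    unfolding curvature_def torsion_def B_def
    by (intro continuous_on_inner continuous_on_cross cont_T cont_T' cont_N cont_N')+
  show "moving_frame I ?T N B (curvature I x N) (\<lambda>_. 0) (torsion I N B)"
    unfolding moving_frame_def
  proof (intro ballI conjI)
    fix s assume s: "s \<in> I"
    note i = oriented_orthonormal_inner[OF o[OF s]]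
    show "oriented_orthonormal (?T s) (N s) (B s)"
      by (rule o[OF s])
    obtain c where "?T' s = c *\<^sub>R N s"
      using normal s by (auto simp: principal_normal_def)
    then have T': "?T' s = curvature I x N s *\<^sub>R N s"
      by (simp add: curvature_def i)
    then show "(?T has_vector_derivative curvature I x N s *\<^sub>R N s + 0 *\<^sub>R B s) (at s within I)"
      using T[OF s] by simp
    have "N s \<bullet> ?N' s + ?N' s \<bullet> N s = 0"
      by (rule inner_derivative_of_constant[OF I s N[OF s] N[OF s] unit(2)])
    moreover have "N s \<bullet> ?T' s + ?N' s \<bullet> ?T s = 0"
      by (rule inner_derivative_of_constant[OF I s N[OF s] T[OF s] unit(3)])
    ultimately have inner: "?N' s \<bullet> N s = 0" "?N' s \<bullet> ?T s = - curvature I x N s"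
      by (simp_all add: T' i inner_commute)
    have N': "?N' s = - curvature I x N s *\<^sub>R ?T s + torsion I N B s *\<^sub>R B s"
      by (rule trans[OF oriented_orthonormal_expand[OF o[OF s]]])
        (simp add: torsion_def inner)
    then show "(N has_vector_derivative - curvature I x N s *\<^sub>R ?T s + torsion I N B s *\<^sub>R B s)
        (at s within I)"
      using N[OF s] by simp
    have "N s = B s \<times> ?T s"
      using oriented_orthonormal_cycle[OF oriented_orthonormal_cycle[OF o[OF s]]]
      by (simp add: oriented_orthonormal_def)
    then have "?T s \<times> B s = - N s"
      using cross_skew[of "?T s" "B s"] by simp
    then have "?T s \<times> ?N' s + ?T' s \<times> N s = - 0 *\<^sub>R ?T s - torsion I N B s *\<^sub>R N s"
      unfolding N' T' cross_add_right cross_mult_right cross_mult_left by simp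
    then show "(B has_vector_derivative - 0 *\<^sub>R ?T s - torsion I N B s *\<^sub>R N s) (at s within I)"
      using has_vector_derivative_cross[OF T[OF s] N[OF s]] unfolding B_def by simp
  qed
qed

text \<open>In a Frenet frame \<open>B\<close> is a multiple of \<open>T \<times> N\<close>; being a unit vector it is \<open>T \<times> N\<close> or its
  negative, and the orientation of the frame selects the first.\<close>

lemma frame_development_moving_frame:
  assumes dev: "frame_development I x N B \<kappa> \<tau>"
  shows "moving_frame I (tangent I x) N B \<kappa> (\<lambda>_. 0) \<tau>"
    and "continuous_on I \<kappa>" "continuous_on I \<tau>"
proof -
  let ?T = "tangent I x"
  have curve: "unit_speed_curve I x" and normal: "principal_normal I x N"
    using dev by (auto simp: frame_development_def frenet_frame_def)
  note frame = principal_normal_moving_frame[OF curve normal]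
  have B: "B s = ?T s \<times> N s" if s: "s \<in> I" for s
  proof -
    have o: "oriented_orthonormal (?T s) (N s) (?T s \<times> N s)"
      using frame(1) s by (auto simp: moving_frame_def)
    have orth: "B s \<bullet> ?T s = 0" "N s \<bullet> B s = 0" "norm (B s) = 1"
      and "?T s \<bullet> (N s \<times> B s) > 0"
      using dev s by (auto simp: frame_development_def frenet_frame_def binormal_def
          unit_field_def dot_cross_det)
    moreover have "?T s \<bullet> (N s \<times> B s) = B s \<bullet> (?T s \<times> N s)"
      by (simp add: cross3_simps)
    moreover define c where "c = B s \<bullet> (?T s \<times> N s)"
    ultimately have "c > 0"
      by simp
    have B: "B s = c *\<^sub>R (?T s \<times> N s)"
      by (rule trans[OF oriented_orthonormal_expand[OF o]]) (use orth in \<open>simp add: c_def inner_commute\<close>)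
    moreover have "norm (?T s \<times> N s) = 1"
      using oriented_orthonormal_inner(3)[OF o] by (simp add: norm_eq_1)
    ultimately have "\<bar>c\<bar> = 1"
      using orth(3) by simp
    then show ?thesis
      using B \<open>c > 0\<close> by simp
  qed
  have \<kappa>\<tau>: "\<kappa> s = curvature I x N s" "\<tau> s = torsion I N (\<lambda>s. ?T s \<times> N s) s" if "s \<in> I" for s
    using dev that B[OF that] by (auto simp: frame_development_def torsion_def)
  show "moving_frame I ?T N B \<kappa> (\<lambda>_. 0) \<tau>"
    by (rule moving_frame_cong[OF frame(1)]) (rule B \<kappa>\<tau> refl; assumption)+
  show "continuous_on I \<kappa>"
    by (rule iffD1[OF continuous_on_cong[OF refl] frame(2)]) (rule \<kappa>\<tau>(1)[symmetric])
  show "continuous_on I \<tau>"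
    by (rule iffD1[OF continuous_on_cong[OF refl] frame(3)]) (rule \<kappa>\<tau>(2)[symmetric])
qed

lemma moving_frame_frame_development:
  assumes I: "nondegenerate_interval I"
    and frame: "moving_frame I P Q R \<kappa> (\<lambda>_. 0) \<tau>"
    and cont: "continuous_on I \<kappa>" "continuous_on I \<tau>"
    and x: "\<And>s. s \<in> I \<Longrightarrow> (x has_vector_derivative P s) (at s within I)"
  shows "unit_speed_curve I x" "frame_development I x Q R \<kappa> \<tau>"
    "\<And>s. s \<in> I \<Longrightarrow> tangent I x s = P s"
proof -
  have P: "(P has_vector_derivative \<kappa> s *\<^sub>R Q s) (at s within I)"
    and Q: "(Q has_vector_derivative - \<kappa> s *\<^sub>R P s + \<tau> s *\<^sub>R R s) (at s within I)"
    and R: "(R has_vector_derivative - \<tau> s *\<^sub>R Q s) (at s within I)"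
    and o: "oriented_orthonormal (P s) (Q s) (R s)" if "s \<in> I" for s
    using frame that by (auto simp: moving_frame_def)
  have contPQR: "continuous_on I P" "continuous_on I Q" "continuous_on I R"
    using has_vector_derivative_imp_continuous_on[OF P] has_vector_derivative_imp_continuous_on[OF Q]
      has_vector_derivative_imp_continuous_on[OF R] by simp_all
  show T: "tangent I x s = P s" if "s \<in> I" for s
    unfolding tangent_def using derivative_on_eq[OF I that x[OF that]] .
  have T': "(tangent I x has_vector_derivative \<kappa> s *\<^sub>R Q s) (at s within I)" if "s \<in> I" for s
    using that T P[OF that] by (rule has_vector_derivative_transform)
  have D: "derivative_on I (tangent I x) s = \<kappa> s *\<^sub>R Q s"
      "derivative_on I Q s = - \<kappa> s *\<^sub>R P s + \<tau> s *\<^sub>R R s"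
      "derivative_on I R s = - \<tau> s *\<^sub>R Q s" if "s \<in> I" for s
    using derivative_on_eq[OF I that] T' P Q R that by blast+
  have C1: "C1_on I x" "C1_on I (tangent I x)" "C1_on I Q" "C1_on I R"
    by (rule C1_onI[OF I x] C1_onI[OF I T'] C1_onI[OF I Q] C1_onI[OF I R]; assumption?;
        intro continuous_intros cont contPQR)+
  note i = oriented_orthonormal_inner[OF o]
  show curve: "unit_speed_curve I x"
    using I C1 T i by (auto simp: unit_speed_curve_def norm_eq_1)
  have "principal_normal I x Q" "binormal I x R"
    using C1 T D i
    by (auto simp: principal_normal_def binormal_def unit_field_def norm_eq_1)
  moreover have "det (vector [tangent I x s, Q s, R s] :: real^3^3) > 0" if "s \<in> I" for s
  proof -
    have "Q s \<times> R s = P s"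
      using oriented_orthonormal_cycle[OF o[OF that]] by (simp add: oriented_orthonormal_def)
    then show ?thesis
      using T i that by (simp add: dot_cross_det[symmetric])
  qed
  ultimately show "frame_development I x Q R \<kappa> \<tau>"
    using curve T D i
    by (auto simp: frame_development_def frenet_frame_def curvature_def torsion_def inner_simps)
qed

section \<open>Frames with the slant helix development\<close>

text \<open>These two fields arise from \<open>(B, T)\<close> by a rotation through \<open>\<phi>\<close>. If \<open>\<phi>\<close> is the angle of a slant
  development, the first one is the unit Darboux vector.\<close>

definition unit_darboux_field :: "(real \<Rightarrow> real) \<Rightarrow> (real \<Rightarrow> real^3) \<Rightarrow> (real \<Rightarrow> real^3) \<Rightarrow> real \<Rightarrow> real^3" where
  "unit_darboux_field \<phi> T B s = cos (\<phi> s) *\<^sub>R B s + sin (\<phi> s) *\<^sub>R T s"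

definition darboux_conormal_field :: "(real \<Rightarrow> real) \<Rightarrow> (real \<Rightarrow> real^3) \<Rightarrow> (real \<Rightarrow> real^3) \<Rightarrow> real \<Rightarrow> real^3" where
  "darboux_conormal_field \<phi> T B s = - sin (\<phi> s) *\<^sub>R B s + cos (\<phi> s) *\<^sub>R T s"

lemma slant_form_sin_cos:
  assumes "slant_form I \<theta> \<phi> \<phi>' \<kappa> \<tau>"
  shows "sin \<theta> > 0" "cos \<theta> > 0" "cot \<theta> \<noteq> 0"
proof -
  have "0 < \<theta>" "\<theta> < pi / 2"
    using assms by (auto simp: slant_form_def)
  then show "sin \<theta> > 0" "cos \<theta> > 0"
    by (auto intro: sin_gt_zero cos_gt_zero)
  then show "cot \<theta> \<noteq> 0"
    by (simp add: cot_def)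
qed

lemma slant_form_curvatures:
  assumes "slant_form I \<theta> \<phi> \<phi>' \<kappa> \<tau>" "s \<in> I"
  shows "\<kappa> s = \<phi>' s / cot \<theta> * cos (\<phi> s)" "\<tau> s = \<phi>' s / cot \<theta> * sin (\<phi> s)"
    "\<kappa> s * cos (\<phi> s) + \<tau> s * sin (\<phi> s) = \<phi>' s / cot \<theta>"
    "\<kappa> s * sin (\<phi> s) - \<tau> s * cos (\<phi> s) = 0"
proof -
  show \<kappa>: "\<kappa> s = \<phi>' s / cot \<theta> * cos (\<phi> s)" and \<tau>: "\<tau> s = \<phi>' s / cot \<theta> * sin (\<phi> s)"
    using assms by (auto simp: slant_form_def)
  show "\<kappa> s * cos (\<phi> s) + \<tau> s * sin (\<phi> s) = \<phi>' s / cot \<theta>"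
    unfolding \<kappa> \<tau> using sin_cos_squared_add[of "\<phi> s"] by algebra
  show "\<kappa> s * sin (\<phi> s) - \<tau> s * cos (\<phi> s) = 0"
    unfolding \<kappa> \<tau> by simp
qed

text \<open>Differentiability of \<open>\<phi>\<close> already gives a continuous derivative, because
  \<open>\<phi>' = cot \<theta> (\<kappa> cos \<phi> + \<tau> sin \<phi>)\<close>.\<close>

lemma slant_form_continuous:
  assumes form: "slant_form I \<theta> \<phi> \<phi>' \<kappa> \<tau>" and cont: "continuous_on I \<kappa>" "continuous_on I \<tau>"
  shows "continuous_on I \<phi>" "continuous_on I \<phi>'"
proof -
  show \<phi>: "continuous_on I \<phi>"
    using form unfolding slant_form_def by (intro DERIV_continuous_on) blast
  have "continuous_on I (\<lambda>s. cot \<theta> * (\<kappa> s * cos (\<phi> s) + \<tau> s * sin (\<phi> s)))"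
    by (intro continuous_intros cont \<phi>)
  moreover have "cot \<theta> * (\<kappa> s * cos (\<phi> s) + \<tau> s * sin (\<phi> s)) = \<phi>' s" if "s \<in> I" for s
    using slant_form_curvatures(3)[OF form that] slant_form_sin_cos(3)[OF form] by simp
  ultimately show "continuous_on I \<phi>'"
    by (rule iffD1[OF continuous_on_cong[OF refl], rotated])
qed

lemma darboux_moving_frame:
  assumes frame: "moving_frame I T N B \<kappa> (\<lambda>_. 0) \<tau>" and form: "slant_form I \<theta> \<phi> \<phi>' \<kappa> \<tau>"
  shows "moving_frame I (unit_darboux_field \<phi> T B) (darboux_conormal_field \<phi> T B) N
    \<phi>' (\<lambda>_. 0) (\<lambda>s. \<phi>' s / cot \<theta>)"
proof -
  have \<phi>: "(\<phi> has_real_derivative \<phi>' s) (at s within I)" if "s \<in> I" for s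
    using form that by (simp add: slant_form_def)
  have "moving_frame I B T N (\<lambda>_. 0) (\<lambda>s. - \<tau> s) \<kappa>"
    using moving_frame_cycle[OF moving_frame_cycle[OF frame]] by simp
  note rotated = moving_frame_rotate[OF this \<phi>]
  show ?thesis
    by (rule moving_frame_cong[OF rotated])
      (use slant_form_curvatures[OF form] in
        \<open>auto simp: unit_darboux_field_def darboux_conormal_field_def algebra_simps\<close>)
qed

text \<open>A quarter turn in the plane of \<open>M\<close> and \<open>N\<close> brings \<open>N\<close> into the position of the tangent. The
  rates that result are those of a Frenet frame with curvature \<open>\<phi>' / cot \<theta>\<close> and torsion \<open>\<phi>'\<close>.\<close>

lemma predecessor_moving_frame:
  assumes "moving_frame I T N B \<kappa> (\<lambda>_. 0) \<tau>" "slant_form I \<theta> \<phi> \<phi>' \<kappa> \<tau>"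
  shows "moving_frame I N (\<lambda>s. - darboux_conormal_field \<phi> T B s) (unit_darboux_field \<phi> T B)
    (\<lambda>s. \<phi>' s / cot \<theta>) (\<lambda>_. 0) \<phi>'"
proof -
  have "((\<lambda>_. pi / 2) has_real_derivative 0) (at s within I)" for s :: real
    by simp
  note rotated = moving_frame_rotate[OF moving_frame_cycle[OF darboux_moving_frame[OF assms]] this]
  show ?thesis
    by (rule moving_frame_cong[OF rotated]) auto
qed

text \<open>Rotating \<open>(N, D)\<close> by \<open>\<theta>\<close> gives \<open>(U, W)\<close>. The rate between \<open>U\<close> and \<open>M\<close> is then
  \<open>- (\<phi>' / cot \<theta>) cos \<theta> + \<phi>' sin \<theta> = 0\<close>, so \<open>U\<close> is fixed, and \<open>(W, M)\<close> turns at the rate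
  \<open>\<phi>' / cos \<theta>\<close>. Turning \<open>(W, M)\<close> back, up to a quarter turn that matches the order of the
  coordinates, gives the fixed vectors \<open>p\<close> and \<open>q\<close>.\<close>

lemma slant_axis_frame:
  assumes I: "convex I" and frame: "moving_frame I T N B \<kappa> (\<lambda>_. 0) \<tau>"
    and form: "slant_form I \<theta> \<phi> \<phi>' \<kappa> \<tau>"
  obtains p q u where "oriented_orthonormal p q u"
    "\<And>s. s \<in> I \<Longrightarrow> N s \<bullet> u = cos \<theta> \<and> unit_darboux_field \<phi> T B s \<bullet> u = sin \<theta>"
    "\<And>s. s \<in> I \<Longrightarrow> T s = (cos (\<phi> s / cos \<theta>) * cos (\<phi> s) + cos \<theta> * sin (\<phi> s / cos \<theta>) * sin (\<phi> s)) *\<^sub>R p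
      + (sin (\<phi> s / cos \<theta>) * cos (\<phi> s) - cos \<theta> * cos (\<phi> s / cos \<theta>) * sin (\<phi> s)) *\<^sub>R q
      + (sin \<theta> * sin (\<phi> s)) *\<^sub>R u"
proof (cases "I = {}")
  case True
  have "oriented_orthonormal (axis 1 1) (axis 2 1) (axis 3 1)"
    by (simp add: oriented_orthonormal_def cross_basis inner_axis_axis)
  then show ?thesis
    using True that by blast
next
  case False
  then obtain s0 where s0: "s0 \<in> I" by blast
  define D where "D = unit_darboux_field \<phi> T B"
  define M where "M = darboux_conormal_field \<phi> T B"
  define \<Omega> where "\<Omega> s = \<phi> s / cos \<theta>" for s
  define U where "U s = cos \<theta> *\<^sub>R N s + sin \<theta> *\<^sub>R D s" for s
  define W where "W s = - sin \<theta> *\<^sub>R N s + cos \<theta> *\<^sub>R D s" for s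
  \<comment> \<open>\<open>P\<close> and \<open>Q\<close> are \<open>W\<close> and \<open>M\<close> rotated by \<open>pi / 2 - \<Omega>\<close>.\<close>
  define P where "P s = sin (\<Omega> s) *\<^sub>R W s + cos (\<Omega> s) *\<^sub>R M s" for s
  define Q where "Q s = - cos (\<Omega> s) *\<^sub>R W s + sin (\<Omega> s) *\<^sub>R M s" for s
  have pos: "cos \<theta> > 0" and cot: "cot \<theta> = cos \<theta> / sin \<theta>"
    using slant_form_sin_cos[OF form] by (auto simp: cot_def)
  have cs: "cos \<theta> * cos \<theta> + sin \<theta> * sin \<theta> = 1"
    by (simp add: power2_eq_square[symmetric])
  have dmn: "moving_frame I D M N \<phi>' (\<lambda>_. 0) (\<lambda>s. \<phi>' s / cot \<theta>)"
    unfolding D_def M_def by (rule darboux_moving_frame[OF frame form])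
  have const: "((\<lambda>_. \<theta>) has_real_derivative 0) (at s within I)" for s :: real
    by simp
  have rates: "\<phi>' s / cot \<theta> * sin \<theta> + \<phi>' s * cos \<theta> = \<phi>' s / cos \<theta>" for s
  proof -
    have "p / (c / q) * q + p * c = p * (c * c + q * q) / c" if "c > 0" for p c q :: real
      using that by (simp add: field_simps)
    from this[OF pos, of "\<phi>' s" "sin \<theta>"] show ?thesis
      unfolding cot cs by simp
  qed
  have "moving_frame I U W M (\<lambda>_. 0) (\<lambda>_. 0) (\<lambda>s. \<phi>' s / cos \<theta>)"
    by (rule moving_frame_cong[OF moving_frame_rotate[OF
          moving_frame_cycle[OF moving_frame_cycle[OF dmn]] const]])
      (use pos rates in \<open>auto simp: U_def W_def cot\<close>)
  then have wmu: "moving_frame I W M U (\<lambda>s. \<phi>' s / cos \<theta>) (\<lambda>_. 0) (\<lambda>_. 0)"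
    using moving_frame_cycle by fastforce
  have "((\<lambda>s. pi / 2 - \<Omega> s) has_real_derivative - (\<phi>' s / cos \<theta>)) (at s within I)" if "s \<in> I" for s
    using form pos that unfolding \<Omega>_def slant_form_def by (auto intro!: derivative_eq_intros)
  note rotated = moving_frame_rotate[OF wmu this]
  have pqu: "moving_frame I P Q U (\<lambda>_. 0) (\<lambda>_. 0) (\<lambda>_. 0)"
    by (rule moving_frame_cong[OF rotated]) (auto simp: P_def Q_def cos_diff sin_diff)
  have const: "P s = P s0" "Q s = Q s0" "U s = U s0" if "s \<in> I" for s
    using moving_frame_constant[OF pqu I that s0] .
  have "oriented_orthonormal (P s0) (Q s0) (U s0)"
    using pqu s0 by (simp add: moving_frame_def)
  moreover have "N s \<bullet> U s0 = cos \<theta> \<and> D s \<bullet> U s0 = sin \<theta>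
    \<and> T s = (cos (\<Omega> s) * cos (\<phi> s) + cos \<theta> * sin (\<Omega> s) * sin (\<phi> s)) *\<^sub>R P s0
      + (sin (\<Omega> s) * cos (\<phi> s) - cos \<theta> * cos (\<Omega> s) * sin (\<phi> s)) *\<^sub>R Q s0
      + (sin \<theta> * sin (\<phi> s)) *\<^sub>R U s0" if s: "s \<in> I" for s
  proof -
    have "oriented_orthonormal (D s) (M s) (N s)" "oriented_orthonormal (T s) (N s) (B s)"
      and o: "oriented_orthonormal (P s0) (Q s0) (U s0)"
      using dmn frame pqu s s0 by (auto simp: moving_frame_def)
    note i = oriented_orthonormal_inner[OF this(1)] oriented_orthonormal_inner[OF this(2)]
    have "T s \<bullet> D s = sin (\<phi> s)" "T s \<bullet> M s = cos (\<phi> s)"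
      by (simp_all add: D_def M_def unit_darboux_field_def darboux_conormal_field_def inner_simps i)
    then have TW: "T s \<bullet> W s = cos \<theta> * sin (\<phi> s)" "T s \<bullet> U s = sin \<theta> * sin (\<phi> s)"
      and TM: "T s \<bullet> M s = cos (\<phi> s)"
      by (simp_all add: W_def U_def inner_simps i)
    then have "T s \<bullet> P s = cos (\<Omega> s) * cos (\<phi> s) + cos \<theta> * sin (\<Omega> s) * sin (\<phi> s)"
      "T s \<bullet> Q s = sin (\<Omega> s) * cos (\<phi> s) - cos \<theta> * cos (\<Omega> s) * sin (\<phi> s)"
      by (simp_all add: P_def Q_def inner_simps)
    note coordinates = this[unfolded const[OF s]] TW(2)[unfolded const[OF s]]
    have "N s \<bullet> U s = cos \<theta>" "D s \<bullet> U s = sin \<theta>"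
      by (simp_all add: U_def inner_simps i)
    then show ?thesis
      using oriented_orthonormal_expand[OF o, of "T s", unfolded coordinates]
      unfolding const(3)[OF s] by blast
  qed
  ultimately show ?thesis
    using that[of "P s0" "Q s0" "U s0"] unfolding D_def \<Omega>_def by blast
qed

lemma slant_helix_tangent_eq:
  assumes "sin \<theta> > 0" "cos \<theta> > 0"
  shows "slant_helix_tangent \<theta> \<phi> s = vector
    [cos (\<phi> s / cos \<theta>) * cos (\<phi> s) + cos \<theta> * sin (\<phi> s / cos \<theta>) * sin (\<phi> s),
     sin (\<phi> s / cos \<theta>) * cos (\<phi> s) - cos \<theta> * cos (\<phi> s / cos \<theta>) * sin (\<phi> s),
     sin \<theta> * sin (\<phi> s)]"
proof -
  define \<Omega> where "\<Omega> = \<phi> s / cos \<theta>"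
  have \<Omega>: "cos \<theta> * \<Omega> = \<phi> s" "(1 - cos \<theta>) * \<Omega> = \<Omega> - \<phi> s" "(1 + cos \<theta>) * \<Omega> = \<Omega> + \<phi> s"
    using assms by (simp_all add: \<Omega>_def field_simps)
  have nm: "cos \<theta> / cot \<theta> = sin \<theta>"
    using assms by (simp add: cot_def)
  show ?thesis
    unfolding slant_helix_tangent_def Let_def \<Omega>_def[symmetric] \<Omega> nm
    by (simp add: vec_eq_iff forall_3 vector_3 cos_add cos_diff sin_add sin_diff algebra_simps)
qed

lemma oriented_orthonormal_rotation_matrix:
  assumes "oriented_orthonormal p q r"
  obtains R where "rotation_matrix R"
    "\<And>a b c. R *v (vector [a, b, c]) = a *\<^sub>R p + b *\<^sub>R q + c *\<^sub>R r"
proof -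
  define A :: "real^3^3" where "A = vector [p, q, r]"
  note i = oriented_orthonormal_inner[OF assms]
  have rows: "row 1 A = p" "row 2 A = q" "row 3 A = r"
    by (simp_all add: A_def row_def vec_eq_iff)
  have "orthogonal_matrix A"
    unfolding orthogonal_matrix_orthonormal_rows
    by (simp add: forall_3 rows norm_eq_1 orthogonal_def i)
  moreover have "q \<times> r = p"
    using oriented_orthonormal_cycle[OF assms] by (simp add: oriented_orthonormal_def)
  then have "det A = 1"
    using dot_cross_det[of p q r] i by (simp add: A_def)
  ultimately have "rotation_matrix (transpose A)"
    by (simp add: rotation_matrix_def det_transpose)
  moreover have "transpose A *v (vector [a, b, c]) = a *\<^sub>R p + b *\<^sub>R q + c *\<^sub>R r" for a b c
    by (simp add: A_def vec_eq_iff matrix_vector_mult_def transpose_def sum_3 algebra_simps)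
  ultimately show ?thesis by (rule that)
qed

lemma slant_tangent_parametrization:
  assumes "convex I" "moving_frame I T N B \<kappa> (\<lambda>_. 0) \<tau>" and form: "slant_form I \<theta> \<phi> \<phi>' \<kappa> \<tau>"
  shows "\<exists>R. rotation_matrix R \<and> (\<forall>s\<in>I. T s = R *v slant_helix_tangent \<theta> \<phi> s)"
proof -
  obtain p q u where o: "oriented_orthonormal p q u"
    and "\<And>s. s \<in> I \<Longrightarrow> N s \<bullet> u = cos \<theta> \<and> unit_darboux_field \<phi> T B s \<bullet> u = sin \<theta>"
    and T: "\<And>s. s \<in> I \<Longrightarrow> T s = (cos (\<phi> s / cos \<theta>) * cos (\<phi> s) + cos \<theta> * sin (\<phi> s / cos \<theta>) * sin (\<phi> s)) *\<^sub>R p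
      + (sin (\<phi> s / cos \<theta>) * cos (\<phi> s) - cos \<theta> * cos (\<phi> s / cos \<theta>) * sin (\<phi> s)) *\<^sub>R q
      + (sin \<theta> * sin (\<phi> s)) *\<^sub>R u"
    by (rule slant_axis_frame[OF assms]) (rule that)
  obtain R where "rotation_matrix R"
    and R: "\<And>a b c. R *v (vector [a, b, c]) = a *\<^sub>R p + b *\<^sub>R q + c *\<^sub>R u"
    by (rule oriented_orthonormal_rotation_matrix[OF o]) (rule that)
  moreover have "T s = R *v slant_helix_tangent \<theta> \<phi> s" if "s \<in> I" for s
    unfolding slant_helix_tangent_eq[OF slant_form_sin_cos(1,2)[OF form]] R by (rule T[OF that])
  ultimately show ?thesis by blast
qed

lemma slant_axis:
  assumes "convex I" "moving_frame I T N B \<kappa> (\<lambda>_. 0) \<tau>" "slant_form I \<theta> \<phi> \<phi>' \<kappa> \<tau>"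
  obtains u where "norm u = 1"
    "\<And>s. s \<in> I \<Longrightarrow> N s \<bullet> u = cos \<theta>" "\<And>s. s \<in> I \<Longrightarrow> unit_darboux_field \<phi> T B s \<bullet> u = sin \<theta>"
proof -
  obtain p q u where o: "oriented_orthonormal p q u"
    and u: "\<And>s. s \<in> I \<Longrightarrow> N s \<bullet> u = cos \<theta> \<and> unit_darboux_field \<phi> T B s \<bullet> u = sin \<theta>"
    by (rule slant_axis_frame[OF assms]) (rule that)
  show ?thesis
    by (rule that[of u]) (use oriented_orthonormal_inner(3)[OF o] u in \<open>simp_all add: norm_eq_1\<close>)
qed

text \<open>The derivatives of \<open>B \<bullet> u\<close> and \<open>T \<bullet> u\<close> are \<open>- \<tau> cos \<theta>\<close> and \<open>\<kappa> cos \<theta>\<close>. Differentiating the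
  constant \<open>N \<bullet> u\<close> gives \<open>\<tau> (B \<bullet> u) = \<kappa> (T \<bullet> u)\<close>, so \<open>(\<kappa>, \<tau>)\<close> is proportional to
  \<open>(B \<bullet> u, T \<bullet> u) = sin \<theta> (cos \<phi>, sin \<phi>)\<close>, and the factor is read off from the derivative of the
  angle \<open>\<phi>\<close>.\<close>

lemma slant_axis_development:
  assumes I: "nondegenerate_interval I" and frame: "moving_frame I T N B \<kappa> (\<lambda>_. 0) \<tau>"
    and cont: "continuous_on I \<kappa>" "continuous_on I \<tau>"
    and \<theta>: "0 < \<theta>" "\<theta> < pi / 2" and u: "norm u = 1" "\<And>s. s \<in> I \<Longrightarrow> N s \<bullet> u = cos \<theta>"
  obtains \<phi> \<phi>' where "slant_form I \<theta> \<phi> \<phi>' \<kappa> \<tau>"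
proof -
  have sc: "sin \<theta> > 0" "cos \<theta> > 0"
    using \<theta> by (auto intro: sin_gt_zero cos_gt_zero)
  define X where "X s = (B s \<bullet> u) / sin \<theta>" for s
  define Y where "Y s = (T s \<bullet> u) / sin \<theta>" for s
  have o: "oriented_orthonormal (T s) (N s) (B s)"
    and T: "(T has_vector_derivative \<kappa> s *\<^sub>R N s) (at s within I)"
    and N: "(N has_vector_derivative - \<kappa> s *\<^sub>R T s + \<tau> s *\<^sub>R B s) (at s within I)"
    and B: "(B has_vector_derivative - \<tau> s *\<^sub>R N s) (at s within I)" if "s \<in> I" for s
    using frame that by (auto simp: moving_frame_def)
  have const: "((\<lambda>_. u) has_vector_derivative 0) (at s within I)" for s
    by simp
  have X: "(X has_real_derivative - \<tau> s * cot \<theta>) (at s within I)" if s: "s \<in> I" for s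
    unfolding X_def using sc u(2)[OF s]
    by (auto intro!: derivative_eq_intros has_vector_derivative_inner[OF B[OF s] const]
        simp: cot_def)
  have Y: "(Y has_real_derivative \<kappa> s * cot \<theta>) (at s within I)" if s: "s \<in> I" for s
    unfolding Y_def using sc u(2)[OF s]
    by (auto intro!: derivative_eq_intros has_vector_derivative_inner[OF T[OF s] const]
        simp: cot_def)
  have balance: "\<tau> s * X s = \<kappa> s * Y s" if s: "s \<in> I" for s
  proof -
    have "N s \<bullet> 0 + (- \<kappa> s *\<^sub>R T s + \<tau> s *\<^sub>R B s) \<bullet> u = 0"
      by (rule inner_derivative_of_constant[OF I s N[OF s] const u(2)])
    then show ?thesis
      using sc by (simp add: X_def Y_def inner_simps)
  qed
  have unit: "(X s)\<^sup>2 + (Y s)\<^sup>2 = 1" if s: "s \<in> I" for s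
  proof -
    note i = oriented_orthonormal_inner[OF o[OF s]]
    have "u \<bullet> u = (u \<bullet> T s) *\<^sub>R T s \<bullet> u + (u \<bullet> N s) *\<^sub>R N s \<bullet> u + (u \<bullet> B s) *\<^sub>R B s \<bullet> u"
      by (subst oriented_orthonormal_expand[OF o[OF s], of u])
        (simp add: inner_simps i inner_commute)
    then have "(T s \<bullet> u)\<^sup>2 + (B s \<bullet> u)\<^sup>2 = (sin \<theta>)\<^sup>2"
      using u(1) u(2)[OF s] sin_cos_squared_add[of \<theta>]
      by (simp add: norm_eq_1 inner_commute power2_eq_square)
    then have "((B s \<bullet> u)\<^sup>2 + (T s \<bullet> u)\<^sup>2) / (sin \<theta>)\<^sup>2 = 1"
      using sc by simp
    then show ?thesis
      by (simp add: X_def Y_def power_divide add_divide_distrib)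
  qed
  have int: "is_interval I"
    using I by (simp add: nondegenerate_interval_def)
  have cont': "continuous_on I (\<lambda>s. - \<tau> s * cot \<theta>)" "continuous_on I (\<lambda>s. \<kappa> s * cot \<theta>)"
    by (intro continuous_intros cont)+
  have tangential: "X s * (- \<tau> s * cot \<theta>) + Y s * (\<kappa> s * cot \<theta>) = 0" if "s \<in> I" for s
    using balance[OF that] by algebra
  obtain \<phi> where \<phi>: "\<And>s. s \<in> I \<Longrightarrow>
      (\<phi> has_real_derivative X s * (\<kappa> s * cot \<theta>) - Y s * (- \<tau> s * cot \<theta>)) (at s within I)"
    and XY: "\<And>s. s \<in> I \<Longrightarrow> X s = cos (\<phi> s) \<and> Y s = sin (\<phi> s)"
    using angle_function[OF int X Y cont' unit tangential] by blast
  have "slant_form I \<theta> \<phi> (\<lambda>s. X s * (\<kappa> s * cot \<theta>) - Y s * (- \<tau> s * cot \<theta>)) \<kappa> \<tau>"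
    unfolding slant_form_def
  proof (intro conjI ballI \<theta> \<phi>)
    fix s assume s: "s \<in> I"
    have cot: "cot \<theta> \<noteq> 0"
      using sc by (simp add: cot_def)
    have "X s * (\<kappa> s * cot \<theta>) - Y s * (- \<tau> s * cot \<theta>) = cot \<theta> * (X s * \<kappa> s + Y s * \<tau> s)"
      by (simp add: algebra_simps)
    then have *: "1 / cot \<theta> * (X s * (\<kappa> s * cot \<theta>) - Y s * (- \<tau> s * cot \<theta>)) = X s * \<kappa> s + Y s * \<tau> s"
      using cot by simp
    have "(X s * \<kappa> s + Y s * \<tau> s) * X s = \<kappa> s" "(X s * \<kappa> s + Y s * \<tau> s) * Y s = \<tau> s"
      using balance[OF s] unit[OF s] by algebra+
    then show "\<kappa> s = 1 / cot \<theta> * (X s * (\<kappa> s * cot \<theta>) - Y s * (- \<tau> s * cot \<theta>)) * cos (\<phi> s)"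
      "\<tau> s = 1 / cot \<theta> * (X s * (\<kappa> s * cot \<theta>) - Y s * (- \<tau> s * cot \<theta>)) * sin (\<phi> s)"
      unfolding * using XY[OF s] by simp_all
  qed
  then show ?thesis by (rule that)
qed

text \<open>On the segment \<open>\<tau> (B \<bullet> u) = (N \<bullet> u)' = 0\<close>, hence \<open>(B \<bullet> u)\<^sup>2\<close> is constant. If this constant is not
  zero, then \<open>\<tau> = 0\<close>; if it is zero, then \<open>0 = (B \<bullet> u)' = - c \<tau>\<close>.\<close>

lemma slant_torsion_vanishes_on_line_segment:
  assumes frame: "moving_frame I T N B \<kappa> (\<lambda>_. 0) \<tau>"
    and u: "\<And>s. s \<in> I \<Longrightarrow> N s \<bullet> u = c" "c \<noteq> 0"
    and J: "nondegenerate_interval J" "J \<subseteq> I" and straight: "\<And>s. s \<in> J \<Longrightarrow> \<kappa> s = 0" and s: "s \<in> J"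
  shows "\<tau> s = 0"
proof -
  have N: "(N has_vector_derivative \<tau> t *\<^sub>R B t) (at t within J)"
    and B: "(B has_vector_derivative - \<tau> t *\<^sub>R N t) (at t within J)" if "t \<in> J" for t
  proof -
    have t: "t \<in> I" "\<kappa> t = 0"
      using J(2) straight[OF that] that by auto
    have "(N has_vector_derivative - \<kappa> t *\<^sub>R T t + \<tau> t *\<^sub>R B t) (at t within I)"
      "(B has_vector_derivative - 0 *\<^sub>R T t - \<tau> t *\<^sub>R N t) (at t within I)"
      using frame t(1) by (simp_all add: moving_frame_def)
    from this[THEN has_vector_derivative_within_subset, OF J(2)]
    show "(N has_vector_derivative \<tau> t *\<^sub>R B t) (at t within J)"
      "(B has_vector_derivative - \<tau> t *\<^sub>R N t) (at t within J)"
      using t(2) by simp_all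
  qed
  have const: "((\<lambda>_. u) has_vector_derivative 0) (at t within J)" for t
    by simp
  have zero: "\<tau> t * (B t \<bullet> u) = 0" if t: "t \<in> J" for t
  proof -
    have "N t \<bullet> 0 + (\<tau> t *\<^sub>R B t) \<bullet> u = 0"
      by (rule inner_derivative_of_constant[OF J(1) t N[OF t] const]) (use u(1) J(2) in \<open>simp add: subset_iff\<close>)
    then show ?thesis by simp
  qed
  have Bu: "((\<lambda>t. B t \<bullet> u) has_real_derivative - c * \<tau> t) (at t within J)" if t: "t \<in> J" for t
  proof -
    have "N t \<bullet> u = c"
      using u(1) J(2) t by blast
    then show ?thesis
      using has_vector_derivative_inner[OF B[OF t] const] by (simp add: mult.commute)
  qed
  have "((\<lambda>t. (B t \<bullet> u)\<^sup>2) has_vector_derivative 0) (at t within J)" if t: "t \<in> J" for t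
    unfolding has_real_derivative_iff_has_vector_derivative[symmetric]
    using zero[OF t] by (auto intro!: derivative_eq_intros Bu[OF t] simp: mult.assoc)
  then have sq: "(B t \<bullet> u)\<^sup>2 = (B s \<bullet> u)\<^sup>2" if "t \<in> J" for t
    using constant_on_interval[of J "\<lambda>t. (B t \<bullet> u)\<^sup>2" t s] nondegenerate_interval_convex[OF J(1)]
      that s by simp
  show ?thesis
  proof (cases "B s \<bullet> u = 0")
    case True
    then have "B t \<bullet> u = 0" if "t \<in> J" for t
      using sq[OF that] by simp
    from has_vector_derivative_transform[where f = "\<lambda>_. 0", OF s this]
    have "((\<lambda>t. B t \<bullet> u) has_vector_derivative 0) (at s within J)"
      by simp
    then have "- c * \<tau> s = 0"
      using real_derivative_unique_on[OF J(1) s Bu[OF s]]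
      by (simp add: has_real_derivative_iff_has_vector_derivative)
    then show ?thesis
      using u(2) by simp
  next
    case False
    then show ?thesis
      using zero[OF s] by simp
  qed
qed

section \<open>The tangent indicatrix\<close>

lemma continuous_nonzero_sign:
  fixes f :: "real \<Rightarrow> real"
  assumes "connected J" "continuous_on J f" "\<And>s. s \<in> J \<Longrightarrow> f s \<noteq> 0"
  obtains \<epsilon> where "\<epsilon> \<in> {1, -1}" "\<And>s. s \<in> J \<Longrightarrow> \<bar>f s\<bar> = \<epsilon> * f s"
proof (cases "\<exists>s\<in>J. f s > 0")
  case True
  then obtain a where a: "a \<in> J" "f a > 0" by blast
  have "f s > 0" if "s \<in> J" for s
  proof (rule ccontr)
    assume "\<not> f s > 0"
    then have "0 \<in> f ` J"
      using a that connected_contains_Icc[OF connected_continuous_image[OF assms(2,1)], of "f s" "f a"]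
      by (auto simp: subset_iff not_less)
    then show False
      using assms(3) by auto
  qed
  then show ?thesis
    by (intro that[of 1]) (simp_all add: abs_of_pos)
next
  case False
  then have "f s < 0" if "s \<in> J" for s
    using assms(3)[OF that] that by force
  then show ?thesis
    by (intro that[of "-1"]) (simp_all add: abs_of_neg)
qed

text \<open>The arc length of the indicatrix is an antiderivative of \<open>\<bar>\<kappa>\<bar>\<close>, and on a regular arc \<open>\<kappa>\<close> has a
  constant sign \<open>\<epsilon>\<close>. After the reparametrization the tangent is \<open>\<epsilon> N\<close>, which makes the angle \<open>\<theta>\<close>
  with \<open>\<epsilon> u\<close>.\<close>

lemma tangent_indicatrix_arc:
  assumes I: "nondegenerate_interval I" and frame: "moving_frame I T N B \<kappa> (\<lambda>_. 0) \<tau>"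
    and cont: "continuous_on I \<kappa>" "continuous_on I \<tau>"
    and \<theta>: "0 < \<theta>" "\<theta> < pi / 2" and u: "norm u = 1" "\<And>s. s \<in> I \<Longrightarrow> N s \<bullet> u = cos \<theta>"
    and arc: "regular_arc I T J"
  shows "\<exists>K y. arc_length_reparametrization J T K y \<and> spherical_helix K y"
proof -
  have J: "nondegenerate_interval J" and sub: "J \<subseteq> I"
    using arc by (auto simp: regular_arc_def)
  have int: "is_interval J"
    using J by (simp add: nondegenerate_interval_def)
  have T_I: "(T has_vector_derivative \<kappa> s *\<^sub>R N s) (at s within I)"
    and N_I: "(N has_vector_derivative - \<kappa> s *\<^sub>R T s + \<tau> s *\<^sub>R B s) (at s within I)"
    and B_I: "(B has_vector_derivative - \<tau> s *\<^sub>R N s) (at s within I)"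
    and o: "oriented_orthonormal (T s) (N s) (B s)" if "s \<in> I" for s
    using frame that by (auto simp: moving_frame_def)
  have T: "(T has_vector_derivative \<kappa> s *\<^sub>R N s) (at s within J)"
    and N: "(N has_vector_derivative - \<kappa> s *\<^sub>R T s + \<tau> s *\<^sub>R B s) (at s within J)"
    and i: "norm (T s) = 1" "norm (N s) = 1" if "s \<in> J" for s
    using has_vector_derivative_within_subset[OF T_I sub] has_vector_derivative_within_subset[OF N_I sub]
      oriented_orthonormal_inner(1,2)[OF o] sub that by (simp_all add: norm_eq_1 subset_iff)
  have deriv: "derivative_on I T s = \<kappa> s *\<^sub>R N s" if "s \<in> I" for s
    by (rule derivative_on_eq[OF I that T_I[OF that]])
  have \<kappa>: "\<kappa> s \<noteq> 0" if "s \<in> J" for s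
    using deriv[of s] arc that sub by (auto simp: regular_arc_def)
  have cont_J: "continuous_on J \<kappa>" "continuous_on J \<tau>" "continuous_on J T" "continuous_on J N" "continuous_on J B"
    using continuous_on_subset[OF cont(1) sub] continuous_on_subset[OF cont(2) sub]
      continuous_on_subset[OF has_vector_derivative_imp_continuous_on[OF T_I] sub]
      continuous_on_subset[OF has_vector_derivative_imp_continuous_on[OF N_I] sub]
      continuous_on_subset[OF has_vector_derivative_imp_continuous_on[OF B_I] sub] by simp_all
  obtain \<epsilon> :: real where \<epsilon>: "\<epsilon> \<in> {1, -1}" and abs: "\<And>s. s \<in> J \<Longrightarrow> \<bar>\<kappa> s\<bar> = \<epsilon> * \<kappa> s"
    using continuous_nonzero_sign[OF _ cont_J(1) \<kappa>] int is_interval_connected_1 by blast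
  have \<epsilon>\<epsilon>: "\<epsilon> * \<epsilon> = 1" "\<bar>\<epsilon>\<bar> = 1"
    using \<epsilon> by auto
  have "continuous_on J (\<lambda>s. \<bar>\<kappa> s\<bar>)"
    by (intro continuous_intros cont_J)
  then obtain \<sigma> where "\<And>s. s \<in> J \<Longrightarrow> (\<sigma> has_vector_derivative \<bar>\<kappa> s\<bar>) (at s within J)"
    using antiderivative_on_interval[OF int] by blast
  then have \<sigma>: "(\<sigma> has_real_derivative \<bar>\<kappa> s\<bar>) (at s within J)" if "s \<in> J" for s
    using that by (simp add: has_real_derivative_iff_has_vector_derivative)
  have pos: "\<bar>\<kappa> s\<bar> > 0" if "s \<in> J" for s
    using \<kappa>[OF that] by simp
  define K where "K = \<sigma> ` J"
  obtain g where K: "nondegenerate_interval K" and g_cont: "continuous_on K g"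
    and g_inv: "\<And>s. s \<in> J \<Longrightarrow> g (\<sigma> s) = s"
    and g: "\<And>s. s \<in> J \<Longrightarrow> (g has_real_derivative 1 / \<bar>\<kappa> s\<bar>) (at (\<sigma> s) within K)"
    using increasing_reparametrization[OF J \<sigma> pos] unfolding K_def by blast
  have gK: "g ` K = J"
    using g_inv by (force simp: K_def)
  have chain: "((\<lambda>k. F (g k)) has_vector_derivative (\<epsilon> / \<kappa> (g k)) *\<^sub>R F' (g k)) (at k within K)"
    if F: "\<And>s. s \<in> J \<Longrightarrow> (F has_vector_derivative F' s) (at s within J)" and k: "k \<in> K"
    for F F' :: "real \<Rightarrow> real^3" and k
  proof -
    obtain s where s: "s \<in> J" "k = \<sigma> s"
      using k by (auto simp: K_def)
    have "1 / \<bar>\<kappa> s\<bar> = \<epsilon> / \<kappa> s"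
      using abs[OF s(1)] \<epsilon> by auto
    then have "(g has_vector_derivative \<epsilon> / \<kappa> s) (at k within K)"
      using g[OF s(1)] s(2) by (simp add: has_real_derivative_iff_has_vector_derivative)
    moreover have "(F has_vector_derivative F' (g k)) (at (g k) within g ` K)"
      unfolding gK using F[of s] s g_inv by simp
    ultimately show ?thesis
      using vector_diff_chain_within[of g "\<epsilon> / \<kappa> s" k K F "F' (g k)"] s g_inv by (simp add: o_def)
  qed
  have gJ: "g k \<in> J" if "k \<in> K" for k
    using gK that by blast
  have comp: "continuous_on K (\<lambda>k. f (g k))" if "continuous_on J f" for f :: "real \<Rightarrow> 'a::topological_space"
    using continuous_on_compose2[OF that g_cont] gK by simp
  define y where "y = (\<lambda>k. T (g k))"
  have y: "(y has_vector_derivative \<epsilon> *\<^sub>R N (g k)) (at k within K)" if k: "k \<in> K" for k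
    using chain[OF T k] \<kappa>[OF gJ[OF k]] by (simp add: y_def)
  have tangent: "tangent K y k = \<epsilon> *\<^sub>R N (g k)" if "k \<in> K" for k
    unfolding tangent_def by (rule derivative_on_eq[OF K that y[OF that]])
  define A where "A s = \<epsilon> *\<^sub>R ((\<epsilon> / \<kappa> s) *\<^sub>R (- \<kappa> s *\<^sub>R T s + \<tau> s *\<^sub>R B s))" for s
  have N_g: "((\<lambda>k. \<epsilon> *\<^sub>R N (g k)) has_vector_derivative A (g k)) (at k within K)" if k: "k \<in> K" for k
    unfolding A_def using bounded_linear.has_vector_derivative[OF bounded_linear_scaleR_right chain[OF N k]] .
  have tangent': "(tangent K y has_vector_derivative A (g k)) (at k within K)" if "k \<in> K" for k
    using that tangent N_g[OF that] by (rule has_vector_derivative_transform)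
  have A_cont: "continuous_on J A"
    unfolding A_def by (intro continuous_intros cont_J ballI \<kappa>)
  have C1: "C1_on K y" "C1_on K (tangent K y)"
    using C1_onI[OF K y continuous_on_scaleR[OF continuous_on_const comp[OF cont_J(4)]]]
      C1_onI[OF K tangent' comp[OF A_cont]] by simp_all
  have curve: "unit_speed_curve K y"
    using K C1 tangent i(2)[OF gJ] \<epsilon>\<epsilon> by (simp add: unit_speed_curve_def)
  have "constant_slope K (tangent K y) \<theta>"
    unfolding constant_slope_def unit_field_def
  proof (intro conjI exI[of _ "\<epsilon> *\<^sub>R u"] ballI)
    fix k assume k: "k \<in> K"
    show "norm (tangent K y k) = 1"
      using curve k by (simp add: unit_speed_curve_def)
    have "tangent K y k \<bullet> \<epsilon> *\<^sub>R u = (\<epsilon> * \<epsilon>) * (N (g k) \<bullet> u)"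
      by (simp add: tangent[OF k])
    also have "\<dots> = cos \<theta>"
      using \<epsilon>\<epsilon> u(2)[of "g k"] gJ[OF k] sub by auto
    finally show "arccos (tangent K y k \<bullet> \<epsilon> *\<^sub>R u) = \<theta>"
      using \<theta> by (simp add: arccos_cos)
  qed (use u(1) \<epsilon>\<epsilon> in simp)
  then have "helix K y"
    using curve \<theta> by (auto simp: helix_def)
  moreover have "y ` K \<subseteq> sphere 0 1"
    using i(1) gJ by (auto simp: y_def)
  ultimately have "spherical_helix K y"
    unfolding spherical_helix_def by (intro conjI exI[of _ 0] exI[of _ 1]) simp_all
  moreover have "norm (derivative_on J T s) = \<bar>\<kappa> s\<bar>" if "s \<in> J" for s
    using derivative_on_eq[OF J that T[OF that]] i(2)[OF that] by simp
  then have "arc_length_reparametrization J T K y"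
    unfolding arc_length_reparametrization_def
    using \<sigma> g_inv by (intro exI[of _ \<sigma>]) (simp add: K_def y_def)
  ultimately show ?thesis by blast
qed

section \<open>Slant helices\<close>

lemma slant_helix_slant_development:
  assumes curve: "unit_speed_curve I x" and slant: "slant_helix I x"
  obtains N B \<kappa> \<tau> \<theta> \<phi> \<phi>' u where "frame_development I x N B \<kappa> \<tau>" "slant_form I \<theta> \<phi> \<phi>' \<kappa> \<tau>"
    "\<And>s. s \<in> I \<Longrightarrow> N s \<bullet> u = cos \<theta>"
proof -
  have I: "nondegenerate_interval I"
    using curve by (simp add: unit_speed_curve_def)
  obtain N \<theta> u where normal: "principal_normal I x N" and \<theta>: "0 < \<theta>" "\<theta> < pi / 2"
    and u: "norm u = 1" "\<And>s. s \<in> I \<Longrightarrow> arccos (N s \<bullet> u) = \<theta>"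
    using slant by (auto simp: slant_helix_def constant_slope_def)
  have slope: "N s \<bullet> u = cos \<theta>" if "s \<in> I" for s
  proof -
    have "norm (N s) = 1"
      using normal that by (auto simp: principal_normal_def unit_field_def)
    then have "\<bar>N s \<bullet> u\<bar> \<le> 1"
      using Cauchy_Schwarz_ineq2[of "N s" u] u(1) by simp
    then show ?thesis
      using u(2)[OF that] cos_arccos_abs by metis
  qed
  define B where "B s = tangent I x s \<times> N s" for s
  let ?\<kappa> = "curvature I x N" and ?\<tau> = "torsion I N B"
  note frame = principal_normal_moving_frame[OF curve normal, folded B_def]
  have x: "(x has_vector_derivative tangent I x s) (at s within I)" if "s \<in> I" for s
    using curve that has_vector_derivative_derivative_on
    by (auto simp: unit_speed_curve_def C1_on_def tangent_def)
  have "frame_development I x N B ?\<kappa> ?\<tau>"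
    by (rule moving_frame_frame_development(2)[OF I frame x])
  moreover obtain \<phi> \<phi>' where "slant_form I \<theta> \<phi> \<phi>' ?\<kappa> ?\<tau>"
    using slant_axis_development[OF I frame \<theta> u(1) slope] by blast
  ultimately show ?thesis
    using that slope by blast
qed

lemma slant_development_slant_helix:
  assumes dev: "frame_development I x N B \<kappa> \<tau>" and form: "slant_form I \<theta> \<phi> \<phi>' \<kappa> \<tau>"
  shows "slant_helix I x"
proof -
  have normal: "principal_normal I x N" and I: "nondegenerate_interval I" and "frenet_curve I x"
    using dev by (auto simp: frame_development_def frenet_frame_def frenet_curve_def unit_speed_curve_def)
  have \<theta>: "0 < \<theta>" "\<theta> < pi / 2"
    using form by (auto simp: slant_form_def)
  obtain u where u: "norm u = 1" "\<And>s. s \<in> I \<Longrightarrow> N s \<bullet> u = cos \<theta>"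
    by (rule slant_axis[OF nondegenerate_interval_convex[OF I]
          frame_development_moving_frame(1)[OF dev] form]) (rule that)
  have "constant_slope I N \<theta>"
    unfolding constant_slope_def using normal u \<theta>
    by (intro conjI exI[of _ u]) (auto simp: principal_normal_def arccos_cos)
  then show ?thesis
    using normal \<theta> \<open>frenet_curve I x\<close> by (auto simp: slant_helix_def)
qed

lemma slant_helix_successor_of_helix:
  assumes dev: "frame_development I x N B \<kappa> \<tau>" and form: "slant_form I \<theta> \<phi> \<phi>' \<kappa> \<tau>"
  shows "\<exists>y. helix I y \<and> successor_curve I y x \<and> frenet_development I y (\<lambda>s. \<phi>' s / cot \<theta>) \<phi>'"
proof -
  have curve: "unit_speed_curve I x" and normal: "principal_normal I x N"
    and I: "nondegenerate_interval I"
    using dev by (auto simp: frame_development_def frenet_frame_def unit_speed_curve_def)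
  note frame = frame_development_moving_frame[OF dev]
  have \<theta>: "0 < \<theta>" "\<theta> < pi / 2"
    using form by (auto simp: slant_form_def)
  obtain u where u: "norm u = 1" "\<And>s. s \<in> I \<Longrightarrow> N s \<bullet> u = cos \<theta>"
    by (rule slant_axis[OF nondegenerate_interval_convex[OF I] frame(1) form]) (rule that)
  have N: "C1_on I N" "continuous_on I N" "\<And>s. s \<in> I \<Longrightarrow> norm (N s) = 1"
    using normal by (auto simp: principal_normal_def C1_on_def unit_field_def
        intro: differentiable_imp_continuous_on)
  obtain y where y: "\<And>s. s \<in> I \<Longrightarrow> (y has_vector_derivative N s) (at s within I)"
    using antiderivative_on_interval[OF _ N(2)] I by (auto simp: nondegenerate_interval_def)
  have \<phi>': "continuous_on I \<phi>'" "continuous_on I (\<lambda>s. \<phi>' s / cot \<theta>)"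
    using slant_form_continuous(2)[OF form frame(2,3)] slant_form_sin_cos(3)[OF form]
    by (auto intro!: continuous_intros)
  note helix_frame = moving_frame_frame_development[OF I
      predecessor_moving_frame[OF frame(1) form] \<phi>'(2,1) y]
  have T: "tangent I y s = N s" if "s \<in> I" for s
    by (rule helix_frame(3)[OF _ that])
  have "constant_slope I (tangent I y) \<theta>"
    unfolding constant_slope_def using N T u \<theta>
    by (intro conjI exI[of _ u]) (auto simp: unit_field_def arccos_cos)
  then have "helix I y"
    using helix_frame(1) \<theta> by (auto simp: helix_def)
  moreover have "principal_normal I x (tangent I y)"
    using normal T helix_frame(1) by (auto simp: principal_normal_def unit_field_def unit_speed_curve_def)
  ultimately show ?thesis
    using curve helix_frame(1,2) by (auto simp: successor_curve_def frenet_development_def)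
qed

lemma slant_helix_darboux:
  assumes dev: "frame_development I x N B \<kappa> \<tau>" and form: "slant_form I \<theta> \<phi> \<phi>' \<kappa> \<tau>"
  shows "\<exists>D. unit_darboux I x N B (\<lambda>s. \<phi>' s / cot \<theta>) D \<and> constant_slope I D (pi / 2 - \<theta>)"
proof -
  let ?D = "unit_darboux_field \<phi> (tangent I x) B"
  have I: "nondegenerate_interval I"
    using dev by (auto simp: frame_development_def frenet_frame_def unit_speed_curve_def)
  note frame = frame_development_moving_frame[OF dev]
  have \<theta>: "0 < \<theta>" "\<theta> < pi / 2"
    using form by (auto simp: slant_form_def)
  obtain u where u: "norm u = 1" "\<And>s. s \<in> I \<Longrightarrow> ?D s \<bullet> u = sin \<theta>"
    by (rule slant_axis[OF nondegenerate_interval_convex[OF I] frame(1) form]) (rule that)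
  have D: "oriented_orthonormal (?D s) (darboux_conormal_field \<phi> (tangent I x) B s) (N s)"
    "(?D has_vector_derivative \<phi>' s *\<^sub>R darboux_conormal_field \<phi> (tangent I x) B s) (at s within I)"
    if "s \<in> I" for s
    using darboux_moving_frame[OF frame(1) form] that by (auto simp: moving_frame_def)
  have unit: "unit_field I ?D"
    using D(1) by (auto simp: unit_field_def oriented_orthonormal_def)
  have "darboux I x N B s = (\<phi>' s / cot \<theta>) *\<^sub>R ?D s" if "s \<in> I" for s
  proof -
    have "curvature I x N s = \<kappa> s" "torsion I N B s = \<tau> s"
      using dev that by (auto simp: frame_development_def)
    then show ?thesis
      using slant_form_curvatures(1,2)[OF form that]
      by (simp add: darboux_def unit_darboux_field_def algebra_simps)
  qed
  then have "unit_darboux I x N B (\<lambda>s. \<phi>' s / cot \<theta>) ?D"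
    using has_vector_derivative_imp_continuous_on[OF D(2)] unit by (simp add: unit_darboux_def)
  moreover have "arccos (?D s \<bullet> u) = pi / 2 - \<theta>" if "s \<in> I" for s
  proof -
    have "arccos (cos (pi / 2 - \<theta>)) = pi / 2 - \<theta>"
      using \<theta> by (intro arccos_cos) auto
    then show ?thesis
      using u(2)[OF that] by (simp add: cos_diff)
  qed
  then have "constant_slope I ?D (pi / 2 - \<theta>)"
    using unit u(1) by (auto simp: constant_slope_def)
  ultimately show ?thesis by blast
qed

lemma slant_helix_generic:
  assumes "unit_speed_curve I x" "slant_helix I x"
  shows "generic_frenet_curve I x"
proof -
  obtain N B \<kappa> \<tau> \<theta> \<phi> \<phi>' u where dev: "frame_development I x N B \<kappa> \<tau>"
    and form: "slant_form I \<theta> \<phi> \<phi>' \<kappa> \<tau>" and u: "\<And>s. s \<in> I \<Longrightarrow> N s \<bullet> u = cos \<theta>"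
    using slant_helix_slant_development[OF assms] by blast
  note frame = frame_development_moving_frame(1)[OF dev]
  have "curvature I x N s = 0 \<and> torsion I N B s = 0" if J: "line_segment I x J" and s: "s \<in> J" for J s
  proof -
    have J': "nondegenerate_interval J" "J \<subseteq> I"
      using J by (auto simp: line_segment_def)
    have eq: "curvature I x N t = \<kappa> t" "torsion I N B t = \<tau> t" if "t \<in> J" for t
      using dev that J' by (auto simp: frame_development_def)
    have \<kappa>: "\<kappa> t = 0" if "t \<in> J" for t
      using J that eq(1)[OF that] by (simp add: line_segment_def curvature_def)
    then have "\<tau> s = 0"
      using slant_torsion_vanishes_on_line_segment[OF frame u _ J' _ s] slant_form_sin_cos(2)[OF form]
      by simp
    then show ?thesis
      using \<kappa>[OF s] eq[OF s] by simp
  qed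
  then have "generic_frame I x N B"
    using dev by (simp add: generic_frame_def frame_development_def)
  then show ?thesis
    by (auto simp: generic_frenet_curve_def)
qed

theorem theorem3p7:
  fixes I :: "real set" and x :: "real \<Rightarrow> real^3"
  assumes "unit_speed_curve I x"
  shows "(slant_helix I x \<longleftrightarrow>
            (\<exists>\<kappa> \<tau> \<theta> \<phi> \<phi>'. frenet_development I x \<kappa> \<tau> \<and> slant_form I \<theta> \<phi> \<phi>' \<kappa> \<tau>)) \<and>
         (\<forall>\<kappa> \<tau> N B \<theta> \<phi> \<phi>'. frame_development I x N B \<kappa> \<tau> \<and> slant_form I \<theta> \<phi> \<phi>' \<kappa> \<tau> \<longrightarrow>
            (\<exists>R. rotation_matrix R \<and>
                 (\<forall>s\<in>I. tangent I x s = R *v slant_helix_tangent \<theta> \<phi> s)) \<and>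
            (\<exists>y. helix I y \<and> successor_curve I y x \<and>
                 frenet_development I y (\<lambda>s. \<phi>' s / cot \<theta>) \<phi>') \<and>
            (\<forall>J. regular_arc I (tangent I x) J \<longrightarrow>
                 (\<exists>K y. arc_length_reparametrization J (tangent I x) K y \<and> spherical_helix K y)) \<and>
            (\<exists>D. unit_darboux I x N B (\<lambda>s. \<phi>' s / cot \<theta>) D \<and>
                 constant_slope I D (pi / 2 - \<theta>))) \<and>
         (slant_helix I x \<longrightarrow> generic_frenet_curve I x)"
proof (intro conjI allI impI)
  have I: "nondegenerate_interval I"
    using assms by (simp add: unit_speed_curve_def)
  show "slant_helix I x \<longleftrightarrow>
      (\<exists>\<kappa> \<tau> \<theta> \<phi> \<phi>'. frenet_development I x \<kappa> \<tau> \<and> slant_form I \<theta> \<phi> \<phi>' \<kappa> \<tau>)"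
    unfolding frenet_development_def
    using slant_helix_slant_development[OF assms] slant_development_slant_helix by metis
  show "generic_frenet_curve I x" if "slant_helix I x"
    by (rule slant_helix_generic[OF assms that])
  fix \<kappa> \<tau> N B \<theta> \<phi> \<phi>'
  assume "frame_development I x N B \<kappa> \<tau> \<and> slant_form I \<theta> \<phi> \<phi>' \<kappa> \<tau>"
  then have dev: "frame_development I x N B \<kappa> \<tau>" and form: "slant_form I \<theta> \<phi> \<phi>' \<kappa> \<tau>"
    by auto
  note frame = frame_development_moving_frame[OF dev]
  note convex = nondegenerate_interval_convex[OF I]
  show "\<exists>R. rotation_matrix R \<and> (\<forall>s\<in>I. tangent I x s = R *v slant_helix_tangent \<theta> \<phi> s)"
    by (rule slant_tangent_parametrization[OF convex frame(1) form])
  show "\<exists>y. helix I y \<and> successor_curve I y x \<and> frenet_development I y (\<lambda>s. \<phi>' s / cot \<theta>) \<phi>'"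
    by (rule slant_helix_successor_of_helix[OF dev form])
  show "\<exists>D. unit_darboux I x N B (\<lambda>s. \<phi>' s / cot \<theta>) D \<and> constant_slope I D (pi / 2 - \<theta>)"
    by (rule slant_helix_darboux[OF dev form])
  fix J assume arc: "regular_arc I (tangent I x) J"
  have \<theta>: "0 < \<theta>" "\<theta> < pi / 2"
    using form by (auto simp: slant_form_def)
  obtain u where u: "norm u = 1" "\<And>s. s \<in> I \<Longrightarrow> N s \<bullet> u = cos \<theta>"
    by (rule slant_axis[OF convex frame(1) form]) (rule that)
  show "\<exists>K y. arc_length_reparametrization J (tangent I x) K y \<and> spherical_helix K y"
    by (rule tangent_indicatrix_arc[OF I frame \<theta> u arc])
qed

end
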